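(* Let $p$ and $q$ be distinct primes, and let $d$ and $e$ be positive integers such that $p$ divides $q^e-1$ and $q$ divides $p^d-1$. Set $R=R_p\times R_q$ where $R_p=\mathrm{GR}(p^2,d)$ and $R_q=\mathrm{GR}(q^2,e)$. Then there exists a non-pure dense S-ring over the ring $R$ that is not a non-trivial generalized wreath product.
   Context: $\mathrm{GR}(p^n,d)$ denotes the Galois ring of characteristic $p^n$ with residue field of order $p^d$ (the unique, up to isomorphism, finite commutative local ring of characteristic $p^n$ with radical generated by $p$ and residue field of order $p^d$). For a finite commutative ring $R$ with identity, $R^+$ is its additive group and $R^\times$ its group of units. S-ring over a finite group $G$: a subring $\mathcal A$ of the group ring $\mathbb Z G$ having a $\mathbb Z$-basis consisting of the elements $\xi(X)=\sum_{x\in X}x$, where $X$ runs over a partition $\mathcal S(\mathcal A)$ of $G$ into non-empty sets (called basic sets) such that $\{1\}\in\mathcal S(\mathcal A)$ and $X\in\mathcal S(\mathcal A)$ implies $X^{-1}\in\mathcal S(\mathcal A)$. S-ring over the ring $R$: an S-ring $\mathcal A$ over the group $R^+$ such that $uX\in\mathcal S(\mathcal A)$ for all $X\in\mathcal S(\mathcal A)$ and $u\in R^\times$. An $\mathcal A$-ideal is an ideal of $R$ that is a union of basic sets of $\mathcal A$. The S-ring $\mathcal A$ is dense if every ideal of $R$ is an $\mathcal A$-ideal. For $X\subset R$, $I_{\rm L}(X)$ is the largest ideal $I$ of $R$ such that $X+I=X$. The S-ring $\mathcal A$ is pure if $I_{\rm L}(X)=0$ for some (equivalently, every) $X\in\mathcal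 S(\mathcal A)$ with $X\cap R^\times\neq\emptyset$. $\mathcal A$ is a non-trivial generalized wreath product if there exist $\mathcal A$-ideals $J\subset I$ with $J\neq 0$, $I\neq R$, such that $J\subset I_{\rm L}(X)$ for every basic set $X$ contained in $R\setminus I$. *)

theory Defs
  imports "HOL-Algebra.Chinese_Remainder" "HOL-Algebra.Subrings" "HOL-Algebra.Elementary_Groups"
    "HOL-Computational_Algebra.Primes" "HOL-Library.Disjoint_Sets" "HOL-Library.Indicator_Function"
begin

section \<open>Galois rings\<close>

text \<open>The (Jacobson) radical of a commutative ring.\<close>

definition ring_radical :: "('a, 'm) ring_scheme \<Rightarrow> 'a set" where
  "ring_radical R = carrier R \<inter> \<Inter> {M. maximalideal M R}"

text \<open>The characteristic of a finite ring is the additive order of its identity. The predicate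
  characterizes \<open>GR(p^n, d)\<close> up to isomorphism.\<close>

definition galois_ring :: "('a, 'm) ring_scheme \<Rightarrow> nat \<Rightarrow> nat \<Rightarrow> nat \<Rightarrow> bool" where
  "galois_ring R p n d \<longleftrightarrow>
     cring R \<and> finite (carrier R) \<and>
     (\<exists>!M. maximalideal M R) \<and>
     group.ord (add_monoid R) \<one>\<^bsub>R\<^esub> = p ^ n \<and>
     ring_radical R = PIdl\<^bsub>R\<^esub> ([p] \<cdot>\<^bsub>R\<^esub> \<one>\<^bsub>R\<^esub>) \<and>
     card (carrier (R Quot ring_radical R)) = p ^ d"

section \<open>S-rings over finite groups\<close>

text \<open>The group ring \<open>\<int>G\<close> of a finite group \<open>G\<close>. The element \<open>\<Sum>x. f x \<cdot> x\<close> is represented by its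
  coefficient function \<open>f\<close>, which vanishes outside \<open>G\<close>; the product is convolution.\<close>

definition int_group_ring :: "('a, 'm) monoid_scheme \<Rightarrow> ('a \<Rightarrow> int) ring" where
  "int_group_ring G =
     \<lparr>carrier = {f. \<forall>x. x \<notin> carrier G \<longrightarrow> f x = 0},
      monoid.mult = (\<lambda>f g x. if x \<in> carrier G
                      then \<Sum>y\<in>carrier G. f y * g (inv\<^bsub>G\<^esub> y \<otimes>\<^bsub>G\<^esub> x) else 0),
      one = indicator {\<one>\<^bsub>G\<^esub>},
      ring.zero = (\<lambda>x. 0),
      add = (\<lambda>f g x. f x + g x)\<rparr>"

text \<open>\<open>B\<close> is a \<open>\<int>\<close>-basis of the additive group \<open>A\<close> of coefficient functions. As \<open>\<Sum>\<close> is 0 over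
  infinite sets, this is meaningful for finite \<open>B\<close> only.\<close>

definition int_basis :: "('a \<Rightarrow> int) set \<Rightarrow> ('a \<Rightarrow> int) set \<Rightarrow> bool" where
  "int_basis B A \<longleftrightarrow>
     B \<subseteq> A \<and> (\<forall>f\<in>A. \<exists>!c. c \<in> B \<rightarrow>\<^sub>E UNIV \<and> f = (\<lambda>x. \<Sum>b\<in>B. c b * b x))"

text \<open>In terms of coefficient functions \<open>\<xi>(X) = \<Sum>x\<in>X. x\<close> is \<open>indicator X\<close>.\<close>

definition basic_partition ::
    "('a, 'm) monoid_scheme \<Rightarrow> ('a \<Rightarrow> int) set \<Rightarrow> 'a set set \<Rightarrow> bool" where
  "basic_partition G A P \<longleftrightarrow>
     partition_on (carrier G) P \<and>
     {\<one>\<^bsub>G\<^esub>} \<in> P \<and>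
     (\<forall>X\<in>P. set_inv\<^bsub>G\<^esub> X \<in> P) \<and>
     int_basis (indicator ` P) A"

definition s_ring :: "('a, 'm) monoid_scheme \<Rightarrow> ('a \<Rightarrow> int) set \<Rightarrow> bool" where
  "s_ring G A \<longleftrightarrow>
     group G \<and> finite (carrier G) \<and>
     subring A (int_group_ring G) \<and>
     (\<exists>P. basic_partition G A P)"

text \<open>\<open>\<S>(A)\<close>; the partition is determined by \<open>A\<close>, see \<open>basic_sets_eq\<close> below.\<close>

definition basic_sets :: "('a, 'm) monoid_scheme \<Rightarrow> ('a \<Rightarrow> int) set \<Rightarrow> 'a set set" where
  "basic_sets G A = (THE P. basic_partition G A P)"

lemma basic_partition_indicator_const:
  assumes "basic_partition G A P" "f \<in> A" "X \<in> P" "x \<in> X" "y \<in> X"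
  shows "f x = f y"
proof -
  obtain c where f: "f = (\<lambda>x. \<Sum>b\<in>indicator ` P. c b * b x)"
    using assms(1,2) unfolding basic_partition_def int_basis_def by blast
  have "b x = b y" if "b \<in> indicator ` P" for b :: "'a \<Rightarrow> int"
  proof -
    obtain Y where Y: "Y \<in> P" "b = indicator Y" using \<open>b \<in> _\<close> by blast
    have "Y = X \<or> Y \<inter> X = {}"
      using assms(1,3) Y(1) unfolding basic_partition_def partition_on_def
      by (auto dest: disjointD)
    with Y(2) assms(4,5) show ?thesis by (auto simp: indicator_def)
  qed
  then show ?thesis unfolding f by (auto intro: sum.cong)
qed

lemma basic_partition_le:
  assumes P: "basic_partition G A P" and Q: "basic_partition G A Q"
    and X: "X \<in> P" and Y: "Y \<in> Q" and x: "x \<in> X" "x \<in> Y"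
  shows "X \<subseteq> Y"
proof
  fix y assume y: "y \<in> X"
  have "(indicator Y :: 'a \<Rightarrow> int) \<in> A"
    using Q Y unfolding basic_partition_def int_basis_def by blast
  then have "(indicator Y x :: int) = indicator Y y"
    using basic_partition_indicator_const[OF P _ X x(1) y] by blast
  with x(2) show "y \<in> Y" by (simp add: indicator_def split: if_splits)
qed

lemma basic_partition_subset:
  assumes P: "basic_partition G A P" and Q: "basic_partition G A Q"
  shows "P \<subseteq> Q"
proof
  fix X assume X: "X \<in> P"
  have "partition_on (carrier G) P" "partition_on (carrier G) Q"
    using P Q unfolding basic_partition_def by auto
  then obtain x Y where "x \<in> X" "x \<in> Y" "Y \<in> Q"
    using X unfolding partition_on_def by (metis UnionE UnionI ex_in_conv)
  then have "X = Y"
    using basic_partition_le[OF P Q X] basic_partition_le[OF Q P _ X] by blast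
  then show "X \<in> Q" using \<open>Y \<in> Q\<close> by simp
qed

lemma basic_sets_eq:
  assumes "basic_partition G A P"
  shows "basic_sets G A = P"
  unfolding basic_sets_def
  using assms basic_partition_subset by (intro the_equality) blast+

section \<open>S-rings over finite commutative rings\<close>

definition ring_s_ring :: "('a, 'm) ring_scheme \<Rightarrow> ('a \<Rightarrow> int) set \<Rightarrow> bool" where
  "ring_s_ring R A \<longleftrightarrow>
     cring R \<and> s_ring (add_monoid R) A \<and>
     (\<forall>X\<in>basic_sets (add_monoid R) A. \<forall>u\<in>Units R.
        u <#\<^bsub>R\<^esub> X \<in> basic_sets (add_monoid R) A)"

definition s_ring_ideal :: "('a, 'm) ring_scheme \<Rightarrow> ('a \<Rightarrow> int) set \<Rightarrow> 'a set \<Rightarrow> bool" where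
  "s_ring_ideal R A I \<longleftrightarrow>
     ideal I R \<and> (\<exists>\<U>\<subseteq>basic_sets (add_monoid R) A. I = \<Union> \<U>)"

definition dense_s_ring :: "('a, 'm) ring_scheme \<Rightarrow> ('a \<Rightarrow> int) set \<Rightarrow> bool" where
  "dense_s_ring R A \<longleftrightarrow> (\<forall>I. ideal I R \<longrightarrow> s_ring_ideal R A I)"

text \<open>\<open>I\<^sub>L(X)\<close>, the largest ideal with respect to inclusion.\<close>

definition ideal_stabilizer :: "('a, 'm) ring_scheme \<Rightarrow> 'a set \<Rightarrow> 'a set" where
  "ideal_stabilizer R X = (GREATEST I. ideal I R \<and> X <+>\<^bsub>R\<^esub> I = X)"

lemma ideal_stabilizer:
  fixes R (structure)
  assumes "ring R" and fin: "finite (carrier R)" and X: "X \<subseteq> carrier R"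
  shows "ideal (ideal_stabilizer R X) R"
    and "X <+> ideal_stabilizer R X = X"
    and "\<And>J. ideal J R \<Longrightarrow> X <+> J = X \<Longrightarrow> J \<subseteq> ideal_stabilizer R X"
proof -
  interpret ring R by fact
  define \<I> where "\<I> = {I. ideal I R \<and> X <+> I = X}"
  have sub: "I \<subseteq> carrier R" if "ideal I R" for I
    using that by (auto dest: ideal.Icarr)
  have "\<I> \<subseteq> Pow (carrier R)" using sub by (auto simp: \<I>_def)
  then have fin\<I>: "finite \<I>" using fin finite_subset by blast
  have "X <+> {\<zero>} = X" using X by (force simp: set_add_def')
  then have "{\<zero>} \<in> \<I>" using zeroideal by (simp add: \<I>_def)
  then have "Max (card ` \<I>) \<in> card ` \<I>" using fin\<I> by (intro Max_in) auto
  then obtain I where I: "I \<in> \<I>" and I_card: "card I = Max (card ` \<I>)" by auto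
  have I_max: "card J \<le> card I" if "J \<in> \<I>" for J
    unfolding I_card using fin\<I> that by simp
  have great: "J \<subseteq> I" if J: "J \<in> \<I>" for J
  proof -
    have i: "ideal I R" "ideal J R" and s: "X <+> I = X" "X <+> J = X"
      using I J by (auto simp: \<I>_def)
    note c = sub[OF i(1)] sub[OF i(2)]
    have "X <+> (I <+> J) = X"
      using add.set_mult_assoc[of X I J] X c s unfolding set_add_def by simp
    then have IJ: "I <+> J \<in> \<I>" using add_ideals[OF i] by (simp add: \<I>_def)
    have z: "\<zero> \<in> I" "\<zero> \<in> J"
      using i by (auto intro: additive_subgroup.zero_closed ideal.axioms(1))
    have "I \<subseteq> I <+> J" "J \<subseteq> I <+> J"
      using z c by (force simp: set_add_def')+
    moreover have "finite (I <+>\<^bsub>R\<^esub> J)"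
      using sub[OF add_ideals[OF i]] fin finite_subset by blast
    ultimately show "J \<subseteq> I" using I_max[OF IJ] card_seteq by blast
  qed
  have "ideal_stabilizer R X = I"
    unfolding ideal_stabilizer_def using I great
    by (intro Greatest_equality) (auto simp: \<I>_def)
  then show "ideal (ideal_stabilizer R X) R"
    and "X <+> ideal_stabilizer R X = X"
    and "\<And>J. ideal J R \<Longrightarrow> X <+> J = X \<Longrightarrow> J \<subseteq> ideal_stabilizer R X"
    using I great by (auto simp: \<I>_def)
qed

definition pure_s_ring :: "('a, 'm) ring_scheme \<Rightarrow> ('a \<Rightarrow> int) set \<Rightarrow> bool" where
  "pure_s_ring R A \<longleftrightarrow>
     (\<exists>X\<in>basic_sets (add_monoid R) A.
        X \<inter> Units R \<noteq> {} \<and> ideal_stabilizer R X = {\<zero>\<^bsub>R\<^esub>})"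

text \<open>The case \<open>J = I\<close> (an ordinary wreath product) is included.\<close>

definition nontrivial_gen_wreath_product ::
    "('a, 'm) ring_scheme \<Rightarrow> ('a \<Rightarrow> int) set \<Rightarrow> bool" where
  "nontrivial_gen_wreath_product R A \<longleftrightarrow>
     (\<exists>I J. s_ring_ideal R A I \<and> s_ring_ideal R A J \<and> J \<subseteq> I \<and>
        J \<noteq> {\<zero>\<^bsub>R\<^esub>} \<and> I \<noteq> carrier R \<and>
        (\<forall>X\<in>basic_sets (add_monoid R) A.
           X \<subseteq> carrier R - I \<longrightarrow> J \<subseteq> ideal_stabilizer R X))"

end

theory Submission
  imports Defs "HOL-Algebra.Sylow"
begin

text \<open>
  Let \<open>N\<close> and \<open>M\<close> be the maximal ideals of \<open>R\<^sub>p\<close> and \<open>R\<^sub>q\<close>; both have square zero. Fix units \<open>s\<close> of \<open>R\<^sub>p\<close>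
  of order \<open>q\<close> and \<open>t\<close> of \<open>R\<^sub>q\<close> of order \<open>p\<close> (here the divisibility conditions enter), and subgroups
  \<open>N\<^sub>0 < N\<close> and \<open>M\<^sub>0 < M\<close> of index \<open>p\<close> and \<open>q\<close>, so that \<open>N = \<int> x\<^sub>0 + N\<^sub>0\<close> and \<open>M = \<int> y\<^sub>0 + M\<^sub>0\<close>. Let \<open>K\<close> consist
  of the pairs \<open>(1 + n, t\<^sup>i)\<close> with \<open>n \<in> i x\<^sub>0 + N\<^sub>0\<close> and \<open>(s\<^sup>j, 1 + m)\<close> with \<open>m \<in> j y\<^sub>0 + M\<^sub>0\<close>. The S-ring
  consists of the \<open>K\<close>-invariant functions that are invariant under translation by \<open>N\<close> on pairs of
  units, and by \<open>M\<close> on \<open>N \<times> R\<^sub>q\<^sup>\<times>\<close>.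

  Closure under convolution is seen by splitting functions along \<open>R\<^sub>p\<^sup>\<times> \<times> R\<^sub>q\<^sup>\<times>\<close>, \<open>N \<times> R\<^sub>q\<^sup>\<times>\<close> and
  \<open>R\<^sub>p \<times> M\<close>: a product with a factor of the first (second) kind is \<open>N\<close>-invariant (\<open>M\<close>-invariant)
  everywhere, and the remaining products are handled by \<open>K\<close>-invariance, since every \<open>1 + n\<close> and
  every \<open>1 + m\<close> is a component of an element of \<open>K\<close>.

  Basic sets of units are \<open>N\<close>-invariant, so the S-ring is not pure. It is not a non-trivial
  generalized wreath product: \<open>K\<close> couples \<open>x\<^sub>0\<close> to \<open>t\<close>, so the basic set of \<open>(1, \<pi>)\<close> with \<open>0 \<noteq> \<pi> \<in> M\<close> is
  not \<open>N\<close>-invariant; it couples \<open>y\<^sub>0\<close> to \<open>s\<close>, so the basic set of \<open>(1, 1)\<close> is not \<open>M\<close>-invariant; and by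
  density the basic sets of \<open>(1, 0)\<close> and \<open>(0, 1)\<close> lie in \<open>R\<^sub>p \<times> 0\<close> and \<open>0 \<times> R\<^sub>q\<close>.
\<close>

section \<open>S-rings of invariant functions\<close>

text \<open>\<open>E\<close> is a set of generating pairs rather than an equivalence, so that
  membership is checked on generators only.\<close>

definition relation_invariants ::
    "('a, 'm) monoid_scheme \<Rightarrow> ('a \<times> 'a) set \<Rightarrow> ('a \<Rightarrow> int) set" where
  "relation_invariants G E =
     {f. (\<forall>x. x \<notin> carrier G \<longrightarrow> f x = 0) \<and> (\<forall>x y. (x, y) \<in> E \<longrightarrow> f x = f y)}"

text \<open>For \<open>E\<close> inside the carrier this is the equivalence relation generated by
  \<open>E\<close>. Defining it through the functions makes the equivalence laws immediate; its
  classes are the candidates for the basic sets.\<close>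

definition invariants_kernel ::
    "('a, 'm) monoid_scheme \<Rightarrow> ('a \<times> 'a) set \<Rightarrow> ('a \<times> 'a) set" where
  "invariants_kernel G E =
     {(x, y). x \<in> carrier G \<and> y \<in> carrier G \<and> (\<forall>f\<in>relation_invariants G E. f x = f y)}"

lemma relation_invariantsI:
  assumes "\<And>x. x \<notin> carrier G \<Longrightarrow> f x = 0" "\<And>x y. (x, y) \<in> E \<Longrightarrow> f x = f y"
  shows "f \<in> relation_invariants G E"
  using assms by (simp add: relation_invariants_def)

lemma equiv_invariants_kernel: "equiv (carrier G) (invariants_kernel G E)"
  by (rule equivI) (auto simp: invariants_kernel_def refl_on_def sym_def trans_def)

text \<open>Every pair of \<open>E\<close> lies in the kernel. This is how indicators of kernel
  classes are seen to be invariant.\<close>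

lemma kernel_constant_in_invariants:
  assumes "E \<subseteq> carrier G \<times> carrier G"
    and "\<And>x. x \<notin> carrier G \<Longrightarrow> f x = 0"
    and "\<And>x y. (x, y) \<in> invariants_kernel G E \<Longrightarrow> f x = f y"
  shows "f \<in> relation_invariants G E"
proof (rule relation_invariantsI)
  fix x y assume "(x, y) \<in> E"
  then have "(x, y) \<in> invariants_kernel G E"
    using assms(1) by (auto simp: invariants_kernel_def relation_invariants_def)
  then show "f x = f y" by (rule assms(3))
qed (rule assms(2))

lemma indicator_kernel_class_in_invariants:
  assumes E: "E \<subseteq> carrier G \<times> carrier G"
    and X: "X \<in> carrier G // invariants_kernel G E"
  shows "indicator X \<in> relation_invariants G E"
proof (rule kernel_constant_in_invariants[OF E])
  have "X \<subseteq> carrier G"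
    using X equiv_invariants_kernel by (meson in_quotient_imp_subset)
  then show "(indicator X x :: int) = 0" if "x \<notin> carrier G" for x
    using that by (auto simp: indicator_def)
next
  fix x y assume xy: "(x, y) \<in> invariants_kernel G E"
  have eq: "equiv (carrier G) (invariants_kernel G E)" by (rule equiv_invariants_kernel)
  have "x \<in> X \<longleftrightarrow> y \<in> X"
    using in_quotient_imp_closed[OF eq X] xy equivE[OF eq] by (meson symD)
  then show "(indicator X x :: int) = indicator X y" by (simp add: indicator_def)
qed

text \<open>At a point of \<open>X\<close> the indicators of all other blocks vanish, so a
  combination of indicators reveals its coefficient at \<open>X\<close>. Existence and uniqueness of
  the coefficients both rest on this.\<close>

lemma indicator_image_sum:
  fixes c :: "('a \<Rightarrow> int) \<Rightarrow> int"
  assumes P: "partition_on C P" and fin: "finite C" and X: "X \<in> P" and x: "x \<in> X"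
  shows "(\<Sum>b\<in>indicator ` P. c b * b x) = c (indicator X)"
proof -
  have finP: "finite P" using P fin by (rule finite_elements[rotated])
  have summand: "c b * b x = (if b = indicator X then c (indicator X) else 0)"
    if "b \<in> indicator ` P" for b :: "'a \<Rightarrow> int"
  proof -
    from that obtain Y where Y: "Y \<in> P" "b = indicator Y" by blast
    show ?thesis
    proof (cases "Y = X")
      case False
      then have "x \<notin> Y" using P X Y(1) x unfolding partition_on_def by (auto dest: disjointD)
      moreover from this x have "b \<noteq> indicator X"
        unfolding Y(2) by (metis indicator_simps zero_neq_one)
      ultimately show ?thesis by (simp add: Y(2))
    qed (simp add: Y(2) x)
  qed
  have "(\<Sum>b\<in>indicator ` P. c b * b x)
      = (\<Sum>b\<in>indicator ` P. if b = (indicator X :: 'a \<Rightarrow> int) then c (indicator X) else 0)"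
    by (rule sum.cong[OF refl]) (rule summand)
  also have "\<dots> = c (indicator X)" using finP X by (simp add: sum.delta')
  finally show ?thesis .
qed

lemma int_basis_invariants:
  assumes fin: "finite (carrier G)" and E: "E \<subseteq> carrier G \<times> carrier G"
  defines "P \<equiv> carrier G // invariants_kernel G E"
  shows "int_basis (indicator ` P) (relation_invariants G E)"
  unfolding int_basis_def
proof (intro conjI ballI)
  show "indicator ` P \<subseteq> relation_invariants G E"
    using indicator_kernel_class_in_invariants[OF E] unfolding P_def by blast
next
  fix f assume f: "f \<in> relation_invariants G E"
  have P: "partition_on (carrier G) P"
    unfolding P_def by (rule partition_on_quotient[OF equiv_invariants_kernel])
  have const: "f x = f y" if "X \<in> P" "x \<in> X" "y \<in> X" for X x y
  proof -
    have "(x, y) \<in> invariants_kernel G E"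
      using that unfolding P_def
      by (intro in_quotient_imp_in_rel[OF equiv_invariants_kernel]) auto
    then show ?thesis using f by (simp add: invariants_kernel_def)
  qed
  have out: "(\<Sum>b\<in>indicator ` P. c b * b x) = 0"
    if "x \<notin> carrier G" for x and c :: "('a \<Rightarrow> int) \<Rightarrow> int"
    using P that unfolding partition_on_def by (auto intro!: sum.neutral simp: indicator_def)
  \<comment> \<open>The coefficient of a class must be the value of \<open>f\<close> at any of its
    points. Such a point is recovered from the indicator as one where it equals 1;
    \<open>restrict\<close> supplies the extensionality that \<open>int_basis\<close>
    demands.\<close>
  define c where
    "c = restrict (\<lambda>b. f (SOME x. b x = (1::int))) (indicator ` P)"
  have c: "c (indicator X) = f x" if "X \<in> P" "x \<in> X" for X x
  proof -
    have "(indicator X (SOME x. indicator X x = (1::int)) :: int) = 1"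
      by (rule someI[of _ x]) (simp add: that)
    then have "(SOME x. indicator X x = (1::int)) \<in> X"
      by (simp add: indicator_def split: if_splits)
    then have "f (SOME x. indicator X x = (1::int)) = f x"
      using const that by blast
    then show ?thesis using that(1) by (simp add: c_def)
  qed
  show "\<exists>!c. c \<in> indicator ` P \<rightarrow>\<^sub>E UNIV \<and> f = (\<lambda>x. \<Sum>b\<in>indicator ` P. c b * b x)"
  proof (rule ex1I[of _ c], intro conjI ext)
    show "c \<in> indicator ` P \<rightarrow>\<^sub>E UNIV" by (simp add: c_def)
    fix x
    show "f x = (\<Sum>b\<in>indicator ` P. c b * b x)"
    proof (cases "x \<in> carrier G")
      case True
      then obtain X where "X \<in> P" "x \<in> X" using P unfolding partition_on_def by blast
      then show ?thesis using indicator_image_sum[OF P fin] c by metis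
    next
      case False
      then show ?thesis using out f by (simp add: relation_invariants_def)
    qed
  next
    fix c' assume c': "c' \<in> indicator ` P \<rightarrow>\<^sub>E UNIV \<and> f = (\<lambda>x. \<Sum>b\<in>indicator ` P. c' b * b x)"
    have eq: "c' b = c b" if "b \<in> indicator ` P" for b
    proof -
      from that obtain X where X: "X \<in> P" "b = indicator X" by blast
      obtain x where x: "x \<in> X" using X P unfolding partition_on_def by fastforce
      have "f x = (\<Sum>b\<in>indicator ` P. c' b * b x)"
        by (subst conjunct2[OF c']) (rule refl)
      then have "f x = c' b" unfolding indicator_image_sum[OF P fin X(1) x] X(2) .
      then show ?thesis using c[OF X(1) x] X(2) by simp
    qed
    have "c \<in> indicator ` P \<rightarrow>\<^sub>E UNIV" by (simp add: c_def)
    with c' show "c' = c" by (blast intro: PiE_ext eq)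
  qed
qed

text \<open>Precomposition with inversion preserves the invariants, so inversion permutes the kernel
  classes; the indicator of the identity separates it from all other elements.\<close>

lemma basic_partition_invariants:
  fixes G (structure)
  assumes "group G" and fin: "finite (carrier G)" and E: "E \<subseteq> carrier G \<times> carrier G"
    and one: "indicator {\<one>} \<in> relation_invariants G E"
    and inv: "\<And>f. f \<in> relation_invariants G E \<Longrightarrow>
      (\<lambda>x. if x \<in> carrier G then f (inv x) else 0) \<in> relation_invariants G E"
  shows "basic_partition G (relation_invariants G E) (carrier G // invariants_kernel G E)"
proof -
  interpret group G by fact
  let ?k = "invariants_kernel G E"
  have eq: "equiv (carrier G) ?k" by (rule equiv_invariants_kernel)
  have cls: "?k `` {x} = {y \<in> carrier G. \<forall>f\<in>relation_invariants G E. f x = f y}"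
    if "x \<in> carrier G" for x
    using that by (auto simp: invariants_kernel_def)
  have "?k `` {\<one>} = {\<one>}"
    using one by (auto simp: cls indicator_def split: if_splits)
  then have 1: "{\<one>} \<in> carrier G // ?k" using quotientI[of "\<one>" "carrier G" ?k] by simp
  have inv_rel: "(inv x, inv y) \<in> ?k" if "(x, y) \<in> ?k" for x y
  proof -
    have xy: "x \<in> carrier G" "y \<in> carrier G"
      and eq: "\<And>f. f \<in> relation_invariants G E \<Longrightarrow> f x = f y"
      using that by (auto simp: invariants_kernel_def)
    have "f (inv x) = f (inv y)" if "f \<in> relation_invariants G E" for f
      using eq[OF inv[OF that]] xy by simp
    then show ?thesis using xy by (simp add: invariants_kernel_def)
  qed
  have 2: "set_inv X \<in> carrier G // ?k" if X: "X \<in> carrier G // ?k" for X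
  proof -
    obtain x where x: "x \<in> carrier G" "X = ?k `` {x}" using X by (rule quotientE)
    have "set_inv X = ?k `` {inv x}"
    proof
      show "set_inv X \<subseteq> ?k `` {inv x}"
        using inv_rel x by (auto simp: SET_INV_def)
      show "?k `` {inv x} \<subseteq> set_inv X"
      proof
        fix y assume "y \<in> ?k `` {inv x}"
        then have "y \<in> carrier G" "(inv (inv x), inv y) \<in> ?k"
          using inv_rel by (auto simp: invariants_kernel_def)
        then have "inv y \<in> X" "y = inv (inv y)" using x by simp_all
        then show "y \<in> set_inv X" unfolding SET_INV_def by blast
      qed
    qed
    then show ?thesis using x by (simp add: quotientI)
  qed
  show ?thesis
    unfolding basic_partition_def
    using 1 2 int_basis_invariants[OF fin E] partition_on_quotient[OF eq] by blast
qed

lemma s_ring_invariants: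
  fixes G (structure)
  assumes "group G" and fin: "finite (carrier G)" and E: "E \<subseteq> carrier G \<times> carrier G"
    and one: "indicator {\<one>} \<in> relation_invariants G E"
    and inv: "\<And>f. f \<in> relation_invariants G E \<Longrightarrow>
      (\<lambda>x. if x \<in> carrier G then f (inv x) else 0) \<in> relation_invariants G E"
    and mult: "\<And>f g. f \<in> relation_invariants G E \<Longrightarrow> g \<in> relation_invariants G E \<Longrightarrow>
      f \<otimes>\<^bsub>int_group_ring G\<^esub> g \<in> relation_invariants G E"
  shows "s_ring G (relation_invariants G E)"
proof -
  let ?A = "relation_invariants G E" and ?Z = "int_group_ring G"
  \<comment> \<open>Being a subgroup involves \<open>m_inv\<close>, a definite description, so the
    pointwise negative is first identified as the inverse.\<close>
  have neg: "inv\<^bsub>add_monoid ?Z\<^esub> f = (\<lambda>x. - f x)" if "f \<in> ?A" for f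
    unfolding m_inv_def
  proof (rule the_equality)
    show "(\<lambda>x. - f x) \<in> carrier (add_monoid ?Z) \<and>
      f \<otimes>\<^bsub>add_monoid ?Z\<^esub> (\<lambda>x. - f x) = \<one>\<^bsub>add_monoid ?Z\<^esub> \<and>
      (\<lambda>x. - f x) \<otimes>\<^bsub>add_monoid ?Z\<^esub> f = \<one>\<^bsub>add_monoid ?Z\<^esub>"
      using that by (simp add: int_group_ring_def relation_invariants_def)
  next
    fix g assume "g \<in> carrier (add_monoid ?Z) \<and>
      f \<otimes>\<^bsub>add_monoid ?Z\<^esub> g = \<one>\<^bsub>add_monoid ?Z\<^esub> \<and>
      g \<otimes>\<^bsub>add_monoid ?Z\<^esub> f = \<one>\<^bsub>add_monoid ?Z\<^esub>"
    then have "(\<lambda>x. f x + g x) = (\<lambda>x. 0)" by (simp add: int_group_ring_def)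
    then show "g = (\<lambda>x. - f x)" by (metis add_eq_0_iff ext)
  qed
  have "subgroup ?A (add_monoid ?Z)"
    by (rule subgroup.intro)
       (use neg in \<open>auto simp: int_group_ring_def relation_invariants_def\<close>)
  moreover have "submonoid ?A ?Z"
    using one mult by unfold_locales (auto simp: int_group_ring_def relation_invariants_def)
  ultimately have "subring ?A ?Z" by (rule subring.intro)
  then show ?thesis
    unfolding s_ring_def using basic_partition_invariants[OF assms(1-5)] assms(1,2) by blast
qed

section \<open>Convolution and direct products of rings\<close>

text \<open>The product of \<open>int_group_ring\<close> over the additive group, written with the
  difference \<open>x - y\<close>. The two agree on the carrier; only the former is forced to vanish
  outside.\<close>

definition convolution :: "('a, 'm) ring_scheme \<Rightarrow> ('a \<Rightarrow> int) \<Rightarrow> ('a \<Rightarrow> int) \<Rightarrow> 'a \<Rightarrow> int" where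
  "convolution R f g x = (\<Sum>y\<in>carrier R. f y * g (x \<ominus>\<^bsub>R\<^esub> y))"

lemma convolution_add_left:
  "convolution R (\<lambda>x. f x + f' x) g x = convolution R f g x + convolution R f' g x"
  by (simp add: convolution_def distrib_right sum.distrib)

lemma convolution_add_right:
  "convolution R f (\<lambda>x. g x + g' x) x = convolution R f g x + convolution R f g' x"
  by (simp add: convolution_def distrib_left sum.distrib)

context ring
begin

lemma bij_betw_minus_const:
  assumes "a \<in> carrier R"
  shows "bij_betw (\<lambda>y. a \<ominus> y) (carrier R) (carrier R)"
  by (rule bij_betwI[where g = "\<lambda>y. a \<ominus> y"]) (use assms in \<open>auto simp: minus_eq minus_add r_neg
      a_assoc[symmetric] r_neg1\<close>)

lemma bij_betw_Units_mult:
  assumes "u \<in> Units R"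
  shows "bij_betw (\<lambda>y. u \<otimes> y) (carrier R) (carrier R)"
  by (rule bij_betwI[where g = "\<lambda>y. inv u \<otimes> y"])
     (use assms in \<open>auto simp: m_assoc[symmetric] Units_closed\<close>)

text \<open>Substitute \<open>x - y\<close> for the summation variable \<open>y\<close>.\<close>

lemma convolution_commute:
  assumes "x \<in> carrier R"
  shows "convolution R f g x = convolution R g f x"
proof -
  have "convolution R f g x = (\<Sum>y\<in>carrier R. f (x \<ominus> y) * g (x \<ominus> (x \<ominus> y)))"
    unfolding convolution_def
    by (rule sum.reindex_bij_betw[OF bij_betw_minus_const[OF assms], symmetric])
  also have "\<dots> = convolution R g f x"
    unfolding convolution_def using assms
    by (intro sum.cong refl) (simp add: minus_eq minus_add a_assoc[symmetric] r_neg mult.commute)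
  finally show ?thesis .
qed

text \<open>Translating the argument shifts only the second factor, so a period of one factor is a
  period of the convolution.\<close>

lemma convolution_translate_right:
  assumes "x \<in> carrier R" "a \<in> carrier R" "\<And>y. y \<in> carrier R \<Longrightarrow> g (y \<oplus> a) = g y"
  shows "convolution R f g (x \<oplus> a) = convolution R f g x"
  unfolding convolution_def
proof (intro sum.cong refl)
  fix y assume "y \<in> carrier R"
  then have "x \<oplus> a \<ominus> y = x \<ominus> y \<oplus> a"
    using assms(1,2) by (simp add: minus_eq a_assoc a_comm[of a])
  then show "f y * g (x \<oplus> a \<ominus> y) = f y * g (x \<ominus> y)"
    using assms(1,3) \<open>y \<in> carrier R\<close> by simp
qed

lemma convolution_translate_left:
  assumes "x \<in> carrier R" "a \<in> carrier R" "\<And>y. y \<in> carrier R \<Longrightarrow> f (y \<oplus> a) = f y"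
  shows "convolution R f g (x \<oplus> a) = convolution R f g x"
  using convolution_translate_right[of x a f g] assms by (simp add: convolution_commute)

text \<open>Multiplication by a unit is an automorphism of the additive group, so it can be applied
  to the summation variable together with the argument.\<close>

lemma convolution_scale:
  assumes u: "u \<in> Units R" and x: "x \<in> carrier R"
    and f: "\<And>y. y \<in> carrier R \<Longrightarrow> f (u \<otimes> y) = f y"
    and g: "\<And>y. y \<in> carrier R \<Longrightarrow> g (u \<otimes> y) = g y"
  shows "convolution R f g (u \<otimes> x) = convolution R f g x"
proof -
  have "convolution R f g (u \<otimes> x) = (\<Sum>y\<in>carrier R. f (u \<otimes> y) * g (u \<otimes> x \<ominus> u \<otimes> y))"
    unfolding convolution_def
    by (rule sum.reindex_bij_betw[OF bij_betw_Units_mult[OF u], symmetric])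
  also have "\<dots> = convolution R f g x"
    unfolding convolution_def
  proof (intro sum.cong refl)
    fix y assume y: "y \<in> carrier R"
    then have "u \<otimes> x \<ominus> u \<otimes> y = u \<otimes> (x \<ominus> y)"
      using u x by (simp add: minus_eq r_distr r_minus Units_closed)
    then show "f (u \<otimes> y) * g (u \<otimes> x \<ominus> u \<otimes> y) = f y * g (x \<ominus> y)"
      using x y f g by simp
  qed
  finally show ?thesis .
qed

lemma int_group_ring_mult:
  "x \<in> carrier R \<Longrightarrow> (f \<otimes>\<^bsub>int_group_ring (add_monoid R)\<^esub> g) x = convolution R f g x"
  unfolding convolution_def int_group_ring_def a_inv_def[symmetric]
  by (auto intro!: sum.cong simp: minus_eq a_comm)

end

declare RDirProd_add_monoid [simp del]

text \<open>The record \<open>add_monoid (RDirProd R S)\<close> contains the field \<open>undefined :: unit\<close>; rewriting it to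
  \<open>()\<close> would make facts about this group inapplicable.\<close>
declare [[simproc del: unit_eq]]

lemma RDirProd_simps:
  "(a, b) \<otimes>\<^bsub>RDirProd R S\<^esub> (a', b') = (a \<otimes>\<^bsub>R\<^esub> a', b \<otimes>\<^bsub>S\<^esub> b')"
  "(a, b) \<oplus>\<^bsub>RDirProd R S\<^esub> (a', b') = (a \<oplus>\<^bsub>R\<^esub> a', b \<oplus>\<^bsub>S\<^esub> b')"
  "\<one>\<^bsub>RDirProd R S\<^esub> = (\<one>\<^bsub>R\<^esub>, \<one>\<^bsub>S\<^esub>)"
  "\<zero>\<^bsub>RDirProd R S\<^esub> = (\<zero>\<^bsub>R\<^esub>, \<zero>\<^bsub>S\<^esub>)"
  by (simp_all add: RDirProd_def DirProd_def monoid.defs)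

lemma RDirProd_cring:
  assumes "cring R" "cring S"
  shows "cring (RDirProd R S)"
proof -
  interpret R: cring R by fact
  interpret S: cring S by fact
  interpret D: ring "RDirProd R S" by (rule RDirProd_ring) unfold_locales
  show ?thesis
    by unfold_locales (auto simp: RDirProd_carrier RDirProd_simps R.m_comm S.m_comm)
qed

lemma RDirProd_minus:
  assumes "ring R" "ring S" "a \<in> carrier R" "b \<in> carrier S" "a' \<in> carrier R" "b' \<in> carrier S"
  shows "(a, b) \<ominus>\<^bsub>RDirProd R S\<^esub> (a', b') = (a \<ominus>\<^bsub>R\<^esub> a', b \<ominus>\<^bsub>S\<^esub> b')"
proof -
  interpret R: ring R by fact
  interpret S: ring S by fact
  interpret D: ring "RDirProd R S" by (rule RDirProd_ring) unfold_locales
  have "\<ominus>\<^bsub>RDirProd R S\<^esub> (a', b') = (\<ominus>\<^bsub>R\<^esub> a', \<ominus>\<^bsub>S\<^esub> b')"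
    by (rule D.minus_equality)
       (use assms in \<open>auto simp: RDirProd_carrier RDirProd_simps R.l_neg S.l_neg\<close>)
  then show ?thesis
    using assms by (simp add: D.minus_eq R.minus_eq S.minus_eq RDirProd_simps)
qed

lemma RDirProd_Units:
  assumes "cring R" "cring S"
  shows "Units (RDirProd R S) = Units R \<times> Units S"
proof -
  interpret R: cring R by fact
  interpret S: cring S by fact
  show ?thesis
    unfolding Units_def RDirProd_carrier RDirProd_simps
    by (auto simp: RDirProd_simps) blast+
qed

section \<open>Gluing over a product of two local rings\<close>

text \<open>\<open>N\<close> and \<open>M\<close> are the sets of non-units, and \<open>K\<close> is
  a set of generators. The lifting conditions serve the convolution: every factor
  \<open>1 + n\<close> or \<open>1 + m\<close> is realized by an element of \<open>K\<close>, at the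
  cost of an uncontrolled other component.\<close>

locale glued_pair = R: cring R + S: cring S
  for R :: "('a, 'm) ring_scheme" (structure) and S :: "('b, 'n) ring_scheme" +
  fixes N :: "'a set" and M :: "'b set" and K :: "('a \<times> 'b) set"
  assumes fin: "finite (carrier R)" "finite (carrier S)"
    and ideals: "ideal N R" "ideal M S"
    and Units: "Units R = carrier R - N" "Units S = carrier S - M"
    and K: "K \<subseteq> Units R \<times> Units S"
    and lift_left: "n \<in> N \<Longrightarrow> \<exists>h. (\<one> \<oplus> n, h) \<in> K"
    and lift_right: "m \<in> M \<Longrightarrow> \<exists>g. (g, \<one>\<^bsub>S\<^esub> \<oplus>\<^bsub>S\<^esub> m) \<in> K"
begin

abbreviation "D \<equiv> RDirProd R S"

definition gluing :: "(('a \<times> 'b) \<times> ('a \<times> 'b)) set" where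
  "gluing =
     {((w, z), (g \<otimes> w, h \<otimes>\<^bsub>S\<^esub> z)) | g h w z. (g, h) \<in> K \<and> w \<in> carrier R \<and> z \<in> carrier S} \<union>
     {((w, z), (w \<oplus> n, z)) | w z n. w \<in> Units R \<and> z \<in> Units S \<and> n \<in> N} \<union>
     {((w, z), (w, z \<oplus>\<^bsub>S\<^esub> m)) | w z m. w \<in> N \<and> z \<in> Units S \<and> m \<in> M}"

definition A :: "('a \<times> 'b \<Rightarrow> int) set" where
  "A = relation_invariants (add_monoid D) gluing"

sublocale D: cring D
  by (rule RDirProd_cring) unfold_locales

sublocale N: ideal N R by (rule ideals)

sublocale M: ideal M S by (rule ideals)

lemma carrier_D: "carrier D = carrier R \<times> carrier S"
  by (rule RDirProd_carrier)

lemma finite_D: "finite (carrier D)"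
  using fin by (simp add: carrier_D)

lemma N_carrier: "n \<in> N \<Longrightarrow> n \<in> carrier R"
  by (rule N.Icarr)

lemma M_carrier: "m \<in> M \<Longrightarrow> m \<in> carrier S"
  by (rule M.Icarr)

lemma unit_plus_N: "w \<in> Units R \<Longrightarrow> n \<in> N \<Longrightarrow> w \<oplus> n \<in> Units R"
proof -
  assume w: "w \<in> Units R" and n: "n \<in> N"
  have "w = (w \<oplus> n) \<oplus> \<ominus> n"
    using R.Units_closed[OF w] N_carrier[OF n] by (simp add: R.a_assoc R.r_neg)
  then have "w \<oplus> n \<notin> N"
    using w n unfolding Units by (metis DiffD2 N.a_closed N.a_inv_closed)
  then show ?thesis using R.Units_closed[OF w] N_carrier[OF n] by (simp add: Units)
qed

lemma unit_plus_M: "z \<in> Units S \<Longrightarrow> m \<in> M \<Longrightarrow> z \<oplus>\<^bsub>S\<^esub> m \<in> Units S"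
proof -
  assume z: "z \<in> Units S" and m: "m \<in> M"
  have "z = (z \<oplus>\<^bsub>S\<^esub> m) \<oplus>\<^bsub>S\<^esub> \<ominus>\<^bsub>S\<^esub> m"
    using S.Units_closed[OF z] M_carrier[OF m] by (simp add: S.a_assoc S.r_neg)
  then have "z \<oplus>\<^bsub>S\<^esub> m \<notin> M"
    using z m unfolding Units by (metis DiffD2 M.a_closed M.a_inv_closed)
  then show ?thesis using S.Units_closed[OF z] M_carrier[OF m] by (simp add: Units)
qed

section \<open>Functions invariant under the gluing\<close>

lemma gluing_subset: "gluing \<subseteq> carrier D \<times> carrier D"
  using K unit_plus_N unit_plus_M N_carrier M_carrier
  by (auto simp: gluing_def carrier_D)

lemma A_iff:
  "f \<in> A \<longleftrightarrow> (\<forall>x. x \<notin> carrier D \<longrightarrow> f x = 0) \<and>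
     (\<forall>(g, h)\<in>K. \<forall>w\<in>carrier R. \<forall>z\<in>carrier S. f (g \<otimes> w, h \<otimes>\<^bsub>S\<^esub> z) = f (w, z)) \<and>
     (\<forall>w\<in>Units R. \<forall>z\<in>Units S. \<forall>n\<in>N. f (w \<oplus> n, z) = f (w, z)) \<and>
     (\<forall>w\<in>N. \<forall>z\<in>Units S. \<forall>m\<in>M. f (w, z \<oplus>\<^bsub>S\<^esub> m) = f (w, z))"
  unfolding A_def relation_invariants_def gluing_def carrier_D by (auto; metis)

lemma AI:
  assumes "\<And>x. x \<notin> carrier D \<Longrightarrow> f x = 0"
    and "\<And>g h w z. (g, h) \<in> K \<Longrightarrow> w \<in> carrier R \<Longrightarrow> z \<in> carrier S \<Longrightarrow>
           f (g \<otimes> w, h \<otimes>\<^bsub>S\<^esub> z) = f (w, z)"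
    and "\<And>w z n. w \<in> Units R \<Longrightarrow> z \<in> Units S \<Longrightarrow> n \<in> N \<Longrightarrow> f (w \<oplus> n, z) = f (w, z)"
    and "\<And>w z m. w \<in> N \<Longrightarrow> z \<in> Units S \<Longrightarrow> m \<in> M \<Longrightarrow> f (w, z \<oplus>\<^bsub>S\<^esub> m) = f (w, z)"
  shows "f \<in> A"
  unfolding A_iff using assms by blast

lemma AD:
  assumes "f \<in> A"
  shows "x \<notin> carrier D \<Longrightarrow> f x = 0"
    and "(g, h) \<in> K \<Longrightarrow> w \<in> carrier R \<Longrightarrow> z \<in> carrier S \<Longrightarrow> f (g \<otimes> w, h \<otimes>\<^bsub>S\<^esub> z) = f (w, z)"
    and "w \<in> Units R \<Longrightarrow> z \<in> Units S \<Longrightarrow> n \<in> N \<Longrightarrow> f (w \<oplus> n, z) = f (w, z)"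
    and "w \<in> N \<Longrightarrow> z \<in> Units S \<Longrightarrow> m \<in> M \<Longrightarrow> f (w, z \<oplus>\<^bsub>S\<^esub> m) = f (w, z)"
  using assms unfolding A_iff by blast+

lemma ideal_mult:
  assumes I: "ideal I D" and x: "(w, z) \<in> I"
  shows "a \<in> carrier R \<Longrightarrow> b \<in> carrier S \<Longrightarrow> (a \<otimes> w, b \<otimes>\<^bsub>S\<^esub> z) \<in> I"
  using ideal.I_l_closed[OF I x, of "(a, b)"] by (simp add: carrier_D RDirProd_simps)

lemma ideal_add:
  assumes I: "ideal I D" and "(w, z) \<in> I" "(w', z') \<in> I"
  shows "(w \<oplus> w', z \<oplus>\<^bsub>S\<^esub> z') \<in> I"
  using additive_subgroup.a_closed[OF ideal.axioms(1)[OF I] assms(2,3)]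
  by (simp add: RDirProd_simps)

section \<open>Splitting functions by support\<close>

definition uu_part :: "('a \<times> 'b \<Rightarrow> int) \<Rightarrow> 'a \<times> 'b \<Rightarrow> int" where
  "uu_part f = (\<lambda>(w, z). if w \<in> Units R \<and> z \<in> Units S then f (w, z) else 0)"

definition nu_part :: "('a \<times> 'b \<Rightarrow> int) \<Rightarrow> 'a \<times> 'b \<Rightarrow> int" where
  "nu_part f = (\<lambda>(w, z). if w \<in> N \<and> z \<in> Units S then f (w, z) else 0)"

definition am_part :: "('a \<times> 'b \<Rightarrow> int) \<Rightarrow> 'a \<times> 'b \<Rightarrow> int" where
  "am_part f = (\<lambda>(w, z). if w \<in> carrier R \<and> z \<in> M then f (w, z) else 0)"

text \<open>The letters name the two factors of the support: \<open>u\<close> for units,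
  \<open>n\<close> for \<open>N\<close>, \<open>a\<close> for all of \<open>R\<close>,
  \<open>m\<close> for \<open>M\<close>. Since \<open>N\<close> and \<open>M\<close> are the
  non-units, the three supports partition the product.\<close>

lemma split_parts:
  assumes "f \<in> A"
  shows "f = (\<lambda>x. uu_part f x + (nu_part f x + am_part f x))"
proof
  fix x show "f x = uu_part f x + (nu_part f x + am_part f x)"
    using AD(1)[OF assms, of x] N_carrier M_carrier
    by (cases x) (auto simp: uu_part_def nu_part_def am_part_def Units carrier_D)
qed

lemma unit_mult_N_iff:
  assumes g: "g \<in> Units R" and w: "w \<in> carrier R"
  shows "g \<otimes> w \<in> N \<longleftrightarrow> w \<in> N"
proof
  assume "g \<otimes> w \<in> N"
  then have "inv g \<otimes> (g \<otimes> w) \<in> N" using g by (auto intro!: N.I_l_closed[of "g \<otimes> w"])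
  moreover have "inv g \<otimes> (g \<otimes> w) = w"
    using g w by (simp add: R.m_assoc[symmetric] R.Units_closed)
  ultimately show "w \<in> N" by metis
qed (use g in \<open>auto intro: N.I_l_closed\<close>)

lemma unit_mult_M_iff:
  assumes h: "h \<in> Units S" and z: "z \<in> carrier S"
  shows "h \<otimes>\<^bsub>S\<^esub> z \<in> M \<longleftrightarrow> z \<in> M"
proof
  assume "h \<otimes>\<^bsub>S\<^esub> z \<in> M"
  then have "inv\<^bsub>S\<^esub> h \<otimes>\<^bsub>S\<^esub> (h \<otimes>\<^bsub>S\<^esub> z) \<in> M" using h by (auto intro!: M.I_l_closed[of "h \<otimes>\<^bsub>S\<^esub> z"])
  moreover have "inv\<^bsub>S\<^esub> h \<otimes>\<^bsub>S\<^esub> (h \<otimes>\<^bsub>S\<^esub> z) = z"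
    using h z by (simp add: S.m_assoc[symmetric] S.Units_closed)
  ultimately show "z \<in> M" by metis
qed (use h in \<open>auto intro: M.I_l_closed\<close>)

lemma plus_N_iff:
  assumes w: "w \<in> carrier R" and n: "n \<in> N"
  shows "w \<oplus> n \<in> N \<longleftrightarrow> w \<in> N"
proof
  assume "w \<oplus> n \<in> N"
  then show "w \<in> N" using unit_plus_N[of w n] w n by (auto simp: Units)
qed (use n in auto)

lemma plus_M_iff:
  assumes z: "z \<in> carrier S" and m: "m \<in> M"
  shows "z \<oplus>\<^bsub>S\<^esub> m \<in> M \<longleftrightarrow> z \<in> M"
proof
  assume "z \<oplus>\<^bsub>S\<^esub> m \<in> M"
  then show "z \<in> M" using unit_plus_M[of z m] z m by (auto simp: Units)
qed (use m in auto)

lemma K_D: "(g, h) \<in> K \<Longrightarrow> g \<in> Units R" "(g, h) \<in> K \<Longrightarrow> h \<in> Units S"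
  using K by auto

lemma uu_part_K:
  assumes "f \<in> A" "(g, h) \<in> K" "w \<in> carrier R" "z \<in> carrier S"
  shows "uu_part f (g \<otimes> w, h \<otimes>\<^bsub>S\<^esub> z) = uu_part f (w, z)"
  using AD(2)[OF assms] K_D[OF assms(2)] assms(3,4)
  by (simp add: uu_part_def Units unit_mult_N_iff[unfolded Units] unit_mult_M_iff[unfolded Units])

lemma am_part_K:
  assumes "f \<in> A" "(g, h) \<in> K" "w \<in> carrier R" "z \<in> carrier S"
  shows "am_part f (g \<otimes> w, h \<otimes>\<^bsub>S\<^esub> z) = am_part f (w, z)"
  using AD(2)[OF assms] K_D[OF assms(2)] assms(3,4)
  by (simp add: am_part_def Units unit_mult_N_iff[unfolded Units] unit_mult_M_iff[unfolded Units])

text \<open>The support of the part is stable under translation by \<open>N\<close>, so invariance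
  on pairs of units becomes a period on all of \<open>D\<close>. The part on
  \<open>N \<times> Units S\<close> behaves likewise under \<open>M\<close>.\<close>

lemma uu_part_translate:
  assumes f: "f \<in> A" and n: "n \<in> N" and x: "x \<in> carrier D"
  shows "uu_part f (x \<oplus>\<^bsub>D\<^esub> (n, \<zero>\<^bsub>S\<^esub>)) = uu_part f x"
  using AD(3)[OF f _ _ n] plus_N_iff[OF _ n] N_carrier[OF n] x
  by (cases x) (auto simp: uu_part_def carrier_D RDirProd_simps Units)

lemma nu_part_translate:
  assumes f: "f \<in> A" and m: "m \<in> M" and x: "x \<in> carrier D"
  shows "nu_part f (x \<oplus>\<^bsub>D\<^esub> (\<zero>, m)) = nu_part f x"
  using AD(4)[OF f _ _ m] plus_M_iff[OF _ m] M_carrier[OF m] x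
  by (cases x) (auto simp: nu_part_def carrier_D RDirProd_simps Units)

section \<open>Convolutions of the parts\<close>

lemma conv_uu_left:
  assumes "f \<in> A" "n \<in> N" "w \<in> carrier R" "z \<in> carrier S"
  shows "convolution D (uu_part f) g (w \<oplus> n, z) = convolution D (uu_part f) g (w, z)"
  using D.convolution_translate_left[of "(w, z)" "(n, \<zero>\<^bsub>S\<^esub>)" "uu_part f" g]
    uu_part_translate[OF assms(1,2)] assms(3,4) N_carrier[OF assms(2)]
  by (simp add: carrier_D RDirProd_simps)

lemma conv_uu_right:
  assumes "g \<in> A" "n \<in> N" "w \<in> carrier R" "z \<in> carrier S"
  shows "convolution D f (uu_part g) (w \<oplus> n, z) = convolution D f (uu_part g) (w, z)"
  using D.convolution_translate_right[of "(w, z)" "(n, \<zero>\<^bsub>S\<^esub>)" "uu_part g" f]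
    uu_part_translate[OF assms(1,2)] assms(3,4) N_carrier[OF assms(2)]
  by (simp add: carrier_D RDirProd_simps)

lemma conv_nu_left:
  assumes "f \<in> A" "m \<in> M" "w \<in> carrier R" "z \<in> carrier S"
  shows "convolution D (nu_part f) g (w, z \<oplus>\<^bsub>S\<^esub> m) = convolution D (nu_part f) g (w, z)"
  using D.convolution_translate_left[of "(w, z)" "(\<zero>, m)" "nu_part f" g]
    nu_part_translate[OF assms(1,2)] assms(3,4) M_carrier[OF assms(2)]
  by (simp add: carrier_D RDirProd_simps)

lemma conv_nu_right:
  assumes "g \<in> A" "m \<in> M" "w \<in> carrier R" "z \<in> carrier S"
  shows "convolution D f (nu_part g) (w, z \<oplus>\<^bsub>S\<^esub> m) = convolution D f (nu_part g) (w, z)"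
  using D.convolution_translate_right[of "(w, z)" "(\<zero>, m)" "nu_part g" f]
    nu_part_translate[OF assms(1,2)] assms(3,4) M_carrier[OF assms(2)]
  by (simp add: carrier_D RDirProd_simps)

lemma convolution_D:
  assumes "w \<in> carrier R" "z \<in> carrier S"
  shows "convolution D f g (w, z) =
    (\<Sum>a\<in>carrier R. \<Sum>b\<in>carrier S. f (a, b) * g (w \<ominus> a, z \<ominus>\<^bsub>S\<^esub> b))"
  unfolding convolution_def carrier_D sum.cartesian_product
  using assms
  by (intro sum.cong refl)
     (auto simp: RDirProd_minus[OF R.ring_axioms S.ring_axioms])

text \<open>Supports add up, and a sum of two elements of \<open>N\<close> is never a unit. The same
  argument with \<open>M\<close> gives \<open>conv_am_am\<close>.\<close>

lemma conv_nu_nu: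
  assumes w: "w \<in> Units R" and z: "z \<in> carrier S"
  shows "convolution D (nu_part f) (nu_part g) (w, z) = 0"
  unfolding convolution_D[OF R.Units_closed[OF w] z]
proof (intro sum.neutral ballI)
  fix a b assume a: "a \<in> carrier R" and b: "b \<in> carrier S"
  have "\<not> (a \<in> N \<and> w \<ominus> a \<in> N)"
  proof
    assume *: "a \<in> N \<and> w \<ominus> a \<in> N"
    then have "w \<ominus> a \<oplus> a \<in> N" by (intro N.a_closed) auto
    then show False using w a by (simp add: Units R.minus_eq R.a_assoc R.l_neg)
  qed
  then show "nu_part f (a, b) * nu_part g (w \<ominus> a, z \<ominus>\<^bsub>S\<^esub> b) = 0"
    by (auto simp: nu_part_def)
qed

lemma conv_am_am:
  assumes w: "w \<in> carrier R" and z: "z \<in> Units S"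
  shows "convolution D (am_part f) (am_part g) (w, z) = 0"
  unfolding convolution_D[OF w S.Units_closed[OF z]]
proof (intro sum.neutral ballI)
  fix a b assume a: "a \<in> carrier R" and b: "b \<in> carrier S"
  have "\<not> (b \<in> M \<and> z \<ominus>\<^bsub>S\<^esub> b \<in> M)"
  proof
    assume *: "b \<in> M \<and> z \<ominus>\<^bsub>S\<^esub> b \<in> M"
    then have "z \<ominus>\<^bsub>S\<^esub> b \<oplus>\<^bsub>S\<^esub> b \<in> M" by (intro M.a_closed) auto
    then show False using z b by (simp add: Units S.minus_eq S.a_assoc S.l_neg)
  qed
  then show "am_part f (a, b) * am_part g (w \<ominus> a, z \<ominus>\<^bsub>S\<^esub> b) = 0"
    by (auto simp: am_part_def)
qed

text \<open>A non-zero summand has \<open>z - b\<close> in \<open>M\<close>, so \<open>b\<close> and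
  \<open>z\<close> differ by an element of \<open>M\<close> and \<open>f (a, b) = f (a, z)\<close>.
  After reindexing, the inner sum no longer depends on \<open>z\<close>: it is the marginal of
  \<open>am_part g\<close> along the second coordinate.\<close>

lemma conv_nu_am_eq:
  assumes f: "f \<in> A" and w: "w \<in> carrier R" and z: "z \<in> Units S"
  shows "convolution D (nu_part f) (am_part g) (w, z) =
    (\<Sum>a\<in>N. f (a, z) * (\<Sum>b\<in>carrier S. am_part g (w \<ominus> a, b)))"
proof -
  have zc: "z \<in> carrier S" using z by (rule S.Units_closed)
  have "convolution D (nu_part f) (am_part g) (w, z) =
      (\<Sum>a\<in>carrier R. \<Sum>b\<in>carrier S.
        (if a \<in> N then f (a, z) else 0) * am_part g (w \<ominus> a, z \<ominus>\<^bsub>S\<^esub> b))"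
    unfolding convolution_D[OF w zc]
  proof (intro sum.cong refl)
    fix a b assume a: "a \<in> carrier R" and b: "b \<in> carrier S"
    show "nu_part f (a, b) * am_part g (w \<ominus> a, z \<ominus>\<^bsub>S\<^esub> b) =
        (if a \<in> N then f (a, z) else 0) * am_part g (w \<ominus> a, z \<ominus>\<^bsub>S\<^esub> b)"
    proof (cases "a \<in> N \<and> z \<ominus>\<^bsub>S\<^esub> b \<in> M")
      case True
      define m where "m = z \<ominus>\<^bsub>S\<^esub> b"
      have zb: "z = b \<oplus>\<^bsub>S\<^esub> m"
        using zc b unfolding m_def
        by (simp add: S.minus_eq S.a_comm[of b] S.a_assoc S.l_neg)
      have m: "m \<in> M" using True by (simp add: m_def)
      have "b \<in> Units S" using plus_M_iff[OF b m] z b by (auto simp: zb Units)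
      then show ?thesis using True AD(4)[OF f _ _ m, of a b] by (simp add: nu_part_def zb[symmetric])
    qed (auto simp: nu_part_def am_part_def)
  qed
  also have "\<dots> = (\<Sum>a\<in>carrier R. (if a \<in> N then f (a, z) else 0) *
      (\<Sum>b\<in>carrier S. am_part g (w \<ominus> a, z \<ominus>\<^bsub>S\<^esub> b)))"
    by (simp add: sum_distrib_left)
  also have "\<dots> = (\<Sum>a\<in>carrier R. (if a \<in> N then f (a, z) else 0) *
      (\<Sum>b\<in>carrier S. am_part g (w \<ominus> a, b)))"
    by (intro sum.cong refl arg_cong[where f = "\<lambda>s. _ * s"]
        sum.reindex_bij_betw[OF S.bij_betw_minus_const[OF zc]])
  also have "\<dots> = (\<Sum>a\<in>N. (if a \<in> N then f (a, z) else 0) *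
      (\<Sum>b\<in>carrier S. am_part g (w \<ominus> a, b)))"
    by (rule sum.mono_neutral_right) (use fin N_carrier in auto)
  also have "\<dots> = (\<Sum>a\<in>N. f (a, z) * (\<Sum>b\<in>carrier S. am_part g (w \<ominus> a, b)))"
    by simp
  finally show ?thesis .
qed

text \<open>Summation over the whole second coordinate absorbs the uncontrolled component
  \<open>h\<close> of a lift, since multiplication by the unit \<open>h\<close> permutes
  \<open>S\<close>.\<close>

lemma am_part_marginal:
  assumes g: "g \<in> A" and w: "w \<in> Units R" and n: "n \<in> N"
  shows "(\<Sum>b\<in>carrier S. am_part g (w \<oplus> n, b)) = (\<Sum>b\<in>carrier S. am_part g (w, b))"
proof -
  \<comment> \<open>Chosen so that \<open>(1 + n') * w = w + n\<close>.\<close>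
  define n' where "n' = inv w \<otimes> n"
  have n': "n' \<in> N" unfolding n'_def using w n by (intro N.I_l_closed) auto
  obtain h where h: "(\<one> \<oplus> n', h) \<in> K" using lift_left[OF n'] by blast
  have wc: "w \<in> carrier R" using w by (rule R.Units_closed)
  have "w \<otimes> n' = n"
    unfolding n'_def using w wc N_carrier[OF n] by (simp add: R.m_assoc[symmetric])
  then have wn: "(\<one> \<oplus> n') \<otimes> w = w \<oplus> n"
    using wc N_carrier[OF n'] by (simp add: R.l_distr R.m_comm[of n'])
  have "(\<Sum>b\<in>carrier S. am_part g (w \<oplus> n, b)) = (\<Sum>b\<in>carrier S. am_part g (w \<oplus> n, h \<otimes>\<^bsub>S\<^esub> b))"
    by (rule sum.reindex_bij_betw[OF S.bij_betw_Units_mult, symmetric]) (rule K_D(2)[OF h])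
  also have "\<dots> = (\<Sum>b\<in>carrier S. am_part g (w, b))"
    using am_part_K[OF g h wc] by (simp add: wn)
  finally show ?thesis .
qed

text \<open>For \<open>a\<close> in \<open>N\<close> the element \<open>w - a\<close> is again a
  unit, so the invariance of the marginal applies to each summand.\<close>

lemma conv_nu_am:
  assumes f: "f \<in> A" and g: "g \<in> A" and w: "w \<in> Units R" and n: "n \<in> N" and z: "z \<in> Units S"
  shows "convolution D (nu_part f) (am_part g) (w \<oplus> n, z) =
    convolution D (nu_part f) (am_part g) (w, z)"
proof -
  have wc: "w \<in> carrier R" "w \<oplus> n \<in> carrier R"
    using w N_carrier[OF n] by (auto intro: R.Units_closed)
  show ?thesis
    unfolding conv_nu_am_eq[OF f wc(1) z] conv_nu_am_eq[OF f wc(2) z]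
  proof (rule sum.cong[OF refl])
    fix a assume a: "a \<in> N"
    have "w \<ominus> a \<in> Units R" unfolding R.minus_eq using w a by (intro unit_plus_N) auto
    moreover have "w \<oplus> n \<ominus> a = w \<ominus> a \<oplus> n"
      using wc N_carrier[OF n] N_carrier[OF a] by (simp add: R.minus_eq R.a_assoc R.a_comm[of n])
    ultimately show "f (a, z) * (\<Sum>b\<in>carrier S. am_part g (w \<oplus> n \<ominus> a, b)) =
        f (a, z) * (\<Sum>b\<in>carrier S. am_part g (w \<ominus> a, b))"
      using am_part_marginal[OF g _ n] by simp
  qed
qed

text \<open>Of the nine products of parts, those with a \<open>uu\<close> factor have period
  \<open>n\<close>, while \<open>nu * nu\<close> and \<open>am * am\<close> vanish at pairs of
  units. The mixed products of \<open>nu\<close> and \<open>am\<close> are covered by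
  \<open>conv_nu_am\<close> and commutativity.\<close>

lemma conv_translate_N:
  assumes f: "f \<in> A" and g: "g \<in> A" and w: "w \<in> Units R" and z: "z \<in> Units S" and n: "n \<in> N"
  shows "convolution D f g (w \<oplus> n, z) = convolution D f g (w, z)"
proof -
  let ?c = "convolution D"
  have split: "?c f g x =
      ?c (uu_part f) g x + (?c (nu_part f) (uu_part g) x + (?c (nu_part f) (nu_part g) x
        + ?c (nu_part f) (am_part g) x)
      + (?c (am_part f) (uu_part g) x + (?c (am_part f) (nu_part g) x + ?c (am_part f) (am_part g) x)))"
    for x
  proof -
    have "?c f g x = ?c (uu_part f) g x + (?c (nu_part f) g x + ?c (am_part f) g x)"
      by (subst split_parts[OF f]) (simp add: convolution_add_left)
    moreover have "?c k g x = ?c k (uu_part g) x + (?c k (nu_part g) x + ?c k (am_part g) x)" for k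
      by (subst split_parts[OF g]) (simp add: convolution_add_right)
    ultimately show ?thesis by simp
  qed
  have wc: "w \<in> carrier R" "w \<oplus> n \<in> carrier R" and zc: "z \<in> carrier S" and wn: "w \<oplus> n \<in> Units R"
    using w z N_carrier[OF n] unit_plus_N[OF w n] by (auto intro: R.Units_closed S.Units_closed)
  have am_nu: "?c (am_part f) (nu_part g) (w \<oplus> n, z) = ?c (am_part f) (nu_part g) (w, z)"
    using conv_nu_am[OF g f w n z] wc zc
      D.convolution_commute[of _ "am_part f" "nu_part g"] by (simp add: carrier_D)
  show ?thesis
    unfolding split
    using conv_uu_left[OF f n wc(1) zc] conv_uu_right[OF g n wc(1) zc] am_nu
      conv_nu_am[OF f g w n z] conv_nu_nu[OF w zc] conv_nu_nu[OF wn zc]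
      conv_am_am[OF wc(1) z] conv_am_am[OF wc(2) z]
    by simp
qed

lemma conv_K:
  assumes "(g, h) \<in> K" "w \<in> carrier R" "z \<in> carrier S"
    and f: "\<And>w z. w \<in> carrier R \<Longrightarrow> z \<in> carrier S \<Longrightarrow> f (g \<otimes> w, h \<otimes>\<^bsub>S\<^esub> z) = f (w, z)"
    and k: "\<And>w z. w \<in> carrier R \<Longrightarrow> z \<in> carrier S \<Longrightarrow> k (g \<otimes> w, h \<otimes>\<^bsub>S\<^esub> z) = k (w, z)"
  shows "convolution D f k (g \<otimes> w, h \<otimes>\<^bsub>S\<^esub> z) = convolution D f k (w, z)"
proof -
  have "(g, h) \<in> Units D"
    using K_D[OF assms(1)] by (simp add: RDirProd_Units[OF R.is_cring S.is_cring])
  from D.convolution_scale[OF this, of "(w, z)" f k] assms(2-)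
  show ?thesis by (auto simp: carrier_D RDirProd_simps)
qed

text \<open>Products with a \<open>nu\<close> factor have period \<open>m\<close>, and
  \<open>am * am\<close> vanishes where the second coordinate is a unit. The remainder
  \<open>B\<close> collects the products with a \<open>uu\<close> factor and no \<open>nu\<close>
  factor.\<close>

lemma conv_translate_M:
  assumes f: "f \<in> A" and g: "g \<in> A" and w: "w \<in> N" and z: "z \<in> Units S" and m: "m \<in> M"
  shows "convolution D f g (w, z \<oplus>\<^bsub>S\<^esub> m) = convolution D f g (w, z)"
proof -
  let ?c = "convolution D"
  define B where "B x = ?c (uu_part f) (uu_part g) x + ?c (uu_part f) (am_part g) x
    + ?c (am_part f) (uu_part g) x" for x
  have split: "?c f g x = ?c (nu_part f) g x + ?c (uu_part f) (nu_part g) x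
      + ?c (am_part f) (nu_part g) x + B x + ?c (am_part f) (am_part g) x"
    for x
  proof -
    have "?c f g x = ?c (uu_part f) g x + (?c (nu_part f) g x + ?c (am_part f) g x)"
      by (subst split_parts[OF f]) (simp add: convolution_add_left)
    moreover have "?c k g x = ?c k (uu_part g) x + (?c k (nu_part g) x + ?c k (am_part g) x)" for k
      by (subst split_parts[OF g]) (simp add: convolution_add_right)
    ultimately show ?thesis by (simp add: B_def)
  qed
  \<comment> \<open>\<open>B\<close> is \<open>N\<close>-invariant, which reduces the claim to \<open>(0, z)\<close>; there the first component of
    an element of \<open>K\<close> acts trivially.\<close>
  have B_N: "B (n, y) = B (\<zero>, y)" if "n \<in> N" "y \<in> carrier S" for n y
    using conv_uu_left[OF f that(1) R.zero_closed that(2)]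
      conv_uu_right[OF g that(1) R.zero_closed that(2)] N_carrier[OF that(1)]
    by (simp add: B_def)
  have wc: "w \<in> carrier R" and zc: "z \<in> carrier S" "z \<oplus>\<^bsub>S\<^esub> m \<in> carrier S"
    and zm: "z \<oplus>\<^bsub>S\<^esub> m \<in> Units S"
    using w z M_carrier[OF m] unit_plus_M[OF z m] N_carrier by (auto intro: S.Units_closed)
  \<comment> \<open>Chosen so that \<open>(1 + m') * z = z + m\<close>.\<close>
  define m' where "m' = inv\<^bsub>S\<^esub> z \<otimes>\<^bsub>S\<^esub> m"
  have m': "m' \<in> M" unfolding m'_def using z m by (intro M.I_l_closed) auto
  obtain k where k: "(k, \<one>\<^bsub>S\<^esub> \<oplus>\<^bsub>S\<^esub> m') \<in> K" using lift_right[OF m'] by blast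
  have "z \<otimes>\<^bsub>S\<^esub> m' = m"
    unfolding m'_def using z zc M_carrier[OF m] by (simp add: S.m_assoc[symmetric])
  then have zm': "(\<one>\<^bsub>S\<^esub> \<oplus>\<^bsub>S\<^esub> m') \<otimes>\<^bsub>S\<^esub> z = z \<oplus>\<^bsub>S\<^esub> m"
    using zc M_carrier[OF m'] by (simp add: S.l_distr S.m_comm[of m'])
  have "B (k \<otimes> \<zero>, (\<one>\<^bsub>S\<^esub> \<oplus>\<^bsub>S\<^esub> m') \<otimes>\<^bsub>S\<^esub> z) = B (\<zero>, z)"
    unfolding B_def using zc(1)
    by (simp only: conv_K[OF k R.zero_closed] uu_part_K[OF f k] uu_part_K[OF g k]
        am_part_K[OF f k] am_part_K[OF g k])
  then have "B (\<zero>, z \<oplus>\<^bsub>S\<^esub> m) = B (\<zero>, z)"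
    using R.Units_closed[OF K_D(1)[OF k]] by (simp add: zm')
  then have "B (w, z \<oplus>\<^bsub>S\<^esub> m) = B (w, z)"
    using B_N[OF w] zc by simp
  then show ?thesis
    unfolding split
    using conv_nu_left[OF f m wc zc(1)] conv_nu_right[OF g m wc zc(1)]
      conv_am_am[OF wc z] conv_am_am[OF wc zm]
    by simp
qed

section \<open>The invariant functions form a dense S-ring over the ring\<close>

lemma mult_closed_A:
  assumes f: "f \<in> A" and g: "g \<in> A"
  shows "f \<otimes>\<^bsub>int_group_ring (add_monoid D)\<^esub> g \<in> A"
proof (rule AI)
  let ?p = "f \<otimes>\<^bsub>int_group_ring (add_monoid D)\<^esub> g"
  have eq: "?p (w, z) = convolution D f g (w, z)" if "w \<in> carrier R" "z \<in> carrier S" for w z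
    using D.int_group_ring_mult that by (simp add: carrier_D)
  show "?p x = 0" if "x \<notin> carrier D" for x
    using that by (simp add: int_group_ring_def)
  show "?p (k \<otimes> w, h \<otimes>\<^bsub>S\<^esub> z) = ?p (w, z)"
    if "(k, h) \<in> K" "w \<in> carrier R" "z \<in> carrier S" for k h w z
  proof -
    have "k \<otimes> w \<in> carrier R" "h \<otimes>\<^bsub>S\<^esub> z \<in> carrier S"
      using that(2,3) R.Units_closed[OF K_D(1)[OF that(1)]] S.Units_closed[OF K_D(2)[OF that(1)]]
      by auto
    then show ?thesis
      using eq conv_K[OF that AD(2)[OF f that(1)] AD(2)[OF g that(1)]] that(2,3) by metis
  qed
  show "?p (w \<oplus> n, z) = ?p (w, z)" if "w \<in> Units R" "z \<in> Units S" "n \<in> N" for w z n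
    using conv_translate_N[OF f g that] that N_carrier
    by (simp add: eq R.Units_closed S.Units_closed)
  show "?p (w, z \<oplus>\<^bsub>S\<^esub> m) = ?p (w, z)" if "w \<in> N" "z \<in> Units S" "m \<in> M" for w z m
    using conv_translate_M[OF f g that] that N_carrier M_carrier
    by (simp add: eq R.Units_closed S.Units_closed)
qed

text \<open>By commutativity \<open>u\<close> passes through \<open>K\<close>, and the ideals
  \<open>N\<close> and \<open>M\<close> absorb its components. The case \<open>u = -1\<close> gives
  closure under inverses, general \<open>u\<close> the unit action on basic sets.\<close>

lemma mult_left_closed_A:
  assumes f: "f \<in> A" and u: "u \<in> Units D"
  shows "(\<lambda>x. if x \<in> carrier D then f (u \<otimes>\<^bsub>D\<^esub> x) else 0) \<in> A"
proof -
  obtain a b where u_def: "u = (a, b)" by (cases u)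
  have a: "a \<in> Units R" and b: "b \<in> Units S"
    using u by (auto simp: u_def RDirProd_Units[OF R.is_cring S.is_cring])
  have ac: "a \<in> carrier R" and bc: "b \<in> carrier S"
    using a b by (auto intro: R.Units_closed S.Units_closed)
  show ?thesis
  proof (rule AI)
    fix g h w z assume gh: "(g, h) \<in> K" and w: "w \<in> carrier R" and z: "z \<in> carrier S"
    have gc: "g \<in> carrier R" and hc: "h \<in> carrier S"
      using K_D[OF gh] by (auto intro: R.Units_closed S.Units_closed)
    have "f (g \<otimes> (a \<otimes> w), h \<otimes>\<^bsub>S\<^esub> (b \<otimes>\<^bsub>S\<^esub> z)) = f (a \<otimes> w, b \<otimes>\<^bsub>S\<^esub> z)"
      using AD(2)[OF f gh] ac bc w z by simp
    then show "(if (g \<otimes> w, h \<otimes>\<^bsub>S\<^esub> z) \<in> carrier D then f (u \<otimes>\<^bsub>D\<^esub> (g \<otimes> w, h \<otimes>\<^bsub>S\<^esub> z)) else 0) =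
        (if (w, z) \<in> carrier D then f (u \<otimes>\<^bsub>D\<^esub> (w, z)) else 0)"
      using ac bc gc hc w z
      by (simp add: carrier_D u_def RDirProd_simps R.m_lcomm[of a g] S.m_lcomm[of b h])
  next
    fix w z n assume w: "w \<in> Units R" and z: "z \<in> Units S" and n: "n \<in> N"
    have "f (a \<otimes> w \<oplus> a \<otimes> n, b \<otimes>\<^bsub>S\<^esub> z) = f (a \<otimes> w, b \<otimes>\<^bsub>S\<^esub> z)"
      using a b w z n ac by (intro AD(3)[OF f]) (auto intro: N.I_l_closed)
    then show "(if (w \<oplus> n, z) \<in> carrier D then f (u \<otimes>\<^bsub>D\<^esub> (w \<oplus> n, z)) else 0) =
        (if (w, z) \<in> carrier D then f (u \<otimes>\<^bsub>D\<^esub> (w, z)) else 0)"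
      using ac R.Units_closed[OF w] S.Units_closed[OF z] N_carrier[OF n]
      by (simp add: carrier_D u_def RDirProd_simps R.r_distr)
  next
    fix w z m assume w: "w \<in> N" and z: "z \<in> Units S" and m: "m \<in> M"
    have "f (a \<otimes> w, b \<otimes>\<^bsub>S\<^esub> z \<oplus>\<^bsub>S\<^esub> b \<otimes>\<^bsub>S\<^esub> m) = f (a \<otimes> w, b \<otimes>\<^bsub>S\<^esub> z)"
      using b w z m ac bc by (intro AD(4)[OF f]) (auto intro: N.I_l_closed M.I_l_closed)
    then show "(if (w, z \<oplus>\<^bsub>S\<^esub> m) \<in> carrier D then f (u \<otimes>\<^bsub>D\<^esub> (w, z \<oplus>\<^bsub>S\<^esub> m)) else 0) =
        (if (w, z) \<in> carrier D then f (u \<otimes>\<^bsub>D\<^esub> (w, z)) else 0)"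
      using bc N_carrier[OF w] S.Units_closed[OF z] M_carrier[OF m]
      by (simp add: carrier_D u_def RDirProd_simps S.r_distr)
  qed simp
qed

text \<open>No generating move crosses the boundary of an ideal: \<open>K\<close> consists of units,
  an ideal containing a pair of units is everything, and an ideal containing \<open>(w, z)\<close>
  with \<open>z\<close> a unit contains \<open>w\<close> paired with all of \<open>S\<close>.
  Density follows from this.\<close>

lemma indicator_ideal_in_A:
  assumes I: "ideal I D"
  shows "indicator I \<in> A"
proof (rule AI)
  have sub: "I \<subseteq> carrier D" using I by (auto dest: ideal.Icarr)
  show "(indicator I x :: int) = 0" if "x \<notin> carrier D" for x
    using that sub by (auto simp: indicator_def)
  show "(indicator I (g \<otimes> w, h \<otimes>\<^bsub>S\<^esub> z) :: int) = indicator I (w, z)"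
    if gh: "(g, h) \<in> K" and w: "w \<in> carrier R" and z: "z \<in> carrier S" for g h w z
  proof -
    have g: "g \<in> Units R" and h: "h \<in> Units S" using K_D[OF gh] by auto
    have "(w, z) \<in> I" if "(g \<otimes> w, h \<otimes>\<^bsub>S\<^esub> z) \<in> I"
      using ideal_mult[OF I that, of "inv g" "inv\<^bsub>S\<^esub> h"] g h w z
      by (simp add: R.m_assoc[symmetric] S.m_assoc[symmetric] R.Units_closed S.Units_closed)
    moreover have "(g \<otimes> w, h \<otimes>\<^bsub>S\<^esub> z) \<in> I" if "(w, z) \<in> I"
      using ideal_mult[OF I that] g h by (simp add: R.Units_closed S.Units_closed)
    ultimately show ?thesis by (auto simp: indicator_def)
  qed
  show "(indicator I (w \<oplus> n, z) :: int) = indicator I (w, z)"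
    if w: "w \<in> Units R" and z: "z \<in> Units S" and n: "n \<in> N" for w z n
  proof -
    have all: "(c, d) \<in> I"
      if "(a, b) \<in> I" "a \<in> Units R" "b \<in> Units S" "c \<in> carrier R" "d \<in> carrier S" for a b c d
      using ideal_mult[OF I that(1), of "c \<otimes> inv a" "d \<otimes>\<^bsub>S\<^esub> inv\<^bsub>S\<^esub> b"] that(2-)
      by (simp add: R.m_assoc S.m_assoc R.Units_closed S.Units_closed)
    have "w \<oplus> n \<in> Units R" using unit_plus_N[OF w n] .
    then have "(w \<oplus> n, z) \<in> I \<longleftrightarrow> (w, z) \<in> I"
      using all w z by (meson R.Units_closed S.Units_closed)
    then show ?thesis by (simp add: indicator_def)
  qed
  show "(indicator I (w, z \<oplus>\<^bsub>S\<^esub> m) :: int) = indicator I (w, z)"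
    if w: "w \<in> N" and z: "z \<in> Units S" and m: "m \<in> M" for w z m
  proof -
    have *: "(w, d) \<in> I"
      if "(w, b) \<in> I" "b \<in> Units S" "d \<in> carrier S" for b d
      using ideal_mult[OF I that(1), of \<one> "d \<otimes>\<^bsub>S\<^esub> inv\<^bsub>S\<^esub> b"] that(2-) N_carrier[OF w]
      by (simp add: S.m_assoc S.Units_closed)
    have "z \<oplus>\<^bsub>S\<^esub> m \<in> Units S" using unit_plus_M[OF z m] .
    then have "(w, z \<oplus>\<^bsub>S\<^esub> m) \<in> I \<longleftrightarrow> (w, z) \<in> I"
      using * z by (meson S.Units_closed)
    then show ?thesis by (simp add: indicator_def)
  qed
qed

lemma group_D: "group (add_monoid D)"
  by (rule D.a_group)

lemma minus_closed_A:
  assumes "f \<in> A"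
  shows "(\<lambda>x. if x \<in> carrier (add_monoid D) then f (inv\<^bsub>add_monoid D\<^esub> x) else 0) \<in> A"
proof -
  have u: "\<ominus>\<^bsub>D\<^esub> \<one>\<^bsub>D\<^esub> \<in> Units D" by (rule D.Units_minus_one_closed)
  have "\<ominus>\<^bsub>D\<^esub> \<one>\<^bsub>D\<^esub> \<otimes>\<^bsub>D\<^esub> x = inv\<^bsub>add_monoid D\<^esub> x" if "x \<in> carrier D" for x
  proof -
    have "\<ominus>\<^bsub>D\<^esub> \<one>\<^bsub>D\<^esub> \<otimes>\<^bsub>D\<^esub> x = \<ominus>\<^bsub>D\<^esub> x" using that by (simp add: D.l_minus)
    then show ?thesis by (simp add: a_inv_def)
  qed
  then show ?thesis
    using mult_left_closed_A[OF assms u] by (simp cong: if_cong)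
qed

lemma one_in_A: "indicator {\<one>\<^bsub>add_monoid D\<^esub>} \<in> A"
  using indicator_ideal_in_A[OF D.zeroideal] by simp

lemma gluing_subset_add_monoid: "gluing \<subseteq> carrier (add_monoid D) \<times> carrier (add_monoid D)"
  using gluing_subset by simp

definition ker :: "(('a \<times> 'b) \<times> ('a \<times> 'b)) set" where
  "ker = invariants_kernel (add_monoid D) gluing"

lemma basic_sets_A: "basic_sets (add_monoid D) A = carrier D // ker"
proof -
  have "basic_partition (add_monoid D) A (carrier (add_monoid D) // ker)"
    using finite_D unfolding A_def ker_def
    by (intro basic_partition_invariants[OF group_D _ gluing_subset_add_monoid one_in_A[unfolded A_def]
          minus_closed_A[unfolded A_def]]) auto
  then show ?thesis by (simp add: basic_sets_eq)
qed

lemma s_ring_A: "s_ring (add_monoid D) A"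
  using finite_D unfolding A_def
  by (intro s_ring_invariants[OF group_D _ gluing_subset_add_monoid one_in_A[unfolded A_def]
        minus_closed_A[unfolded A_def] mult_closed_A[unfolded A_def]]) auto

lemma equiv_ker: "equiv (carrier D) ker"
  using equiv_invariants_kernel[of "add_monoid D" gluing] by (simp add: ker_def)

lemma ker_iff:
  "(x, y) \<in> ker \<longleftrightarrow> x \<in> carrier D \<and> y \<in> carrier D \<and> (\<forall>f\<in>A. f x = f y)"
  by (simp add: A_def ker_def invariants_kernel_def)

lemma ker_mult:
  assumes "(x, y) \<in> ker" "u \<in> Units D"
  shows "(u \<otimes>\<^bsub>D\<^esub> x, u \<otimes>\<^bsub>D\<^esub> y) \<in> ker"
proof -
  have xy: "x \<in> carrier D" "y \<in> carrier D" and eq: "\<And>f. f \<in> A \<Longrightarrow> f x = f y"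
    using assms(1) by (auto simp: ker_iff)
  have "f (u \<otimes>\<^bsub>D\<^esub> x) = f (u \<otimes>\<^bsub>D\<^esub> y)" if "f \<in> A" for f
    using eq[OF mult_left_closed_A[OF that assms(2)]] xy by simp
  then show ?thesis using xy D.Units_closed[OF assms(2)] by (simp add: ker_iff)
qed

lemma ring_s_ring_A: "ring_s_ring D A"
  unfolding ring_s_ring_def basic_sets_A
proof (intro conjI ballI)
  show "cring D" by (rule D.is_cring)
  show "s_ring (add_monoid D) A" by (rule s_ring_A)
  fix X u assume X: "X \<in> carrier D // ker" and u: "u \<in> Units D"
  obtain x where x: "x \<in> carrier D" "X = ker `` {x}" using X by (rule quotientE)
  have uc: "u \<in> carrier D" by (rule D.Units_closed[OF u])
  have "u <#\<^bsub>D\<^esub> X = ker `` {u \<otimes>\<^bsub>D\<^esub> x}"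
  proof
    show "u <#\<^bsub>D\<^esub> X \<subseteq> ker `` {u \<otimes>\<^bsub>D\<^esub> x}"
      using ker_mult[OF _ u] by (auto simp: l_coset_def x(2))
    show "ker `` {u \<otimes>\<^bsub>D\<^esub> x} \<subseteq> u <#\<^bsub>D\<^esub> X"
    proof
      fix y assume "y \<in> ker `` {u \<otimes>\<^bsub>D\<^esub> x}"
      then have y: "(u \<otimes>\<^bsub>D\<^esub> x, y) \<in> ker" by simp
      then have yc: "y \<in> carrier D" by (simp add: ker_iff)
      have "(inv\<^bsub>D\<^esub> u \<otimes>\<^bsub>D\<^esub> (u \<otimes>\<^bsub>D\<^esub> x), inv\<^bsub>D\<^esub> u \<otimes>\<^bsub>D\<^esub> y) \<in> ker"
        using ker_mult[OF y] u by simp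
      then have "inv\<^bsub>D\<^esub> u \<otimes>\<^bsub>D\<^esub> y \<in> X"
        using u uc x by (simp add: D.m_assoc[symmetric])
      moreover have "y = u \<otimes>\<^bsub>D\<^esub> (inv\<^bsub>D\<^esub> u \<otimes>\<^bsub>D\<^esub> y)"
        using u uc yc by (simp add: D.m_assoc[symmetric])
      ultimately show "y \<in> u <#\<^bsub>D\<^esub> X" unfolding l_coset_def by blast
    qed
  qed
  then show "u <#\<^bsub>D\<^esub> X \<in> carrier D // ker" using uc x by (simp add: quotientI)
qed

lemma ker_ideal:
  assumes "ideal I D" "(x, y) \<in> ker" "x \<in> I"
  shows "y \<in> I"
proof -
  have "(indicator I x :: int) = indicator I y"
    using assms(2) indicator_ideal_in_A[OF assms(1)] by (simp add: ker_iff)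
  with assms(3) show ?thesis by (simp add: indicator_def split: if_splits)
qed

text \<open>Principal ideals are unions of basic sets, so the members of one basic set divide each
  other.\<close>

lemma ker_dvd:
  assumes "(x, y) \<in> ker"
  obtains r where "r \<in> carrier D" "y = r \<otimes>\<^bsub>D\<^esub> x"
proof -
  have "x \<in> carrier D" using assms by (simp add: ker_iff)
  then have "y \<in> PIdl\<^bsub>D\<^esub> x"
    using ker_ideal[OF D.cgenideal_ideal assms D.cgenideal_self] by blast
  then show ?thesis using that unfolding cgenideal_def by blast
qed

lemma dense_A: "dense_s_ring D A"
  unfolding dense_s_ring_def s_ring_ideal_def basic_sets_A
proof (intro allI impI conjI)
  fix I assume I: "ideal I D"
  then show "ideal I D" .
  have sub: "I \<subseteq> carrier D" using I by (auto dest: ideal.Icarr)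
  have "I = \<Union> ((\<lambda>x. ker `` {x}) ` I)"
    using ker_ideal[OF I] sub equiv_class_self[OF equiv_ker] by blast
  moreover have "(\<lambda>x. ker `` {x}) ` I \<subseteq> carrier D // ker"
    using sub by (auto intro: quotientI)
  ultimately show "\<exists>\<U>\<subseteq>carrier D // ker. I = \<Union> \<U>" by blast
qed

section \<open>Purity and generalized wreath products\<close>

lemma ideal_Times_zero: "ideal (N \<times> {\<zero>\<^bsub>S\<^esub>}) D"
proof (rule idealI)
  show "ring D" by (rule D.ring_axioms)
  show "subgroup (N \<times> {\<zero>\<^bsub>S\<^esub>}) (add_monoid D)"
    using DirProd_subgroups[OF R.a_group N.a_subgroup S.a_group S.add.triv_subgroup]
    by (simp add: RDirProd_add_monoid)
qed (auto simp: carrier_D RDirProd_simps intro: N.I_l_closed N.I_r_closed)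

text \<open>A basic set containing a unit consists of units, since its members divide that unit. On
  pairs of units the gluing includes translation by \<open>N\<close>, so the non-zero ideal
  \<open>N \<times> {0}\<close> stabilizes the set.\<close>

lemma not_pure_A:
  assumes "N \<noteq> {\<zero>}"
  shows "\<not> pure_s_ring D A"
  unfolding pure_s_ring_def basic_sets_A
proof
  assume "\<exists>X\<in>carrier D // ker. X \<inter> Units D \<noteq> {} \<and> ideal_stabilizer D X = {\<zero>\<^bsub>D\<^esub>}"
  then obtain X x where X: "X \<in> carrier D // ker" "x \<in> X" "x \<in> Units D"
    and stab: "ideal_stabilizer D X = {\<zero>\<^bsub>D\<^esub>}" by blast
  have Xc: "X \<subseteq> carrier D" using X(1) in_quotient_imp_subset[OF equiv_ker] by simp
  have X_units: "X \<subseteq> Units D"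
  proof
    fix y assume "y \<in> X"
    then have yx: "(y, x) \<in> ker" using X(1,2) quotient_eq_iff[OF equiv_ker X(1) X(1)] by blast
    then have y: "y \<in> carrier D" by (simp add: ker_iff)
    obtain r where r: "r \<in> carrier D" "x = r \<otimes>\<^bsub>D\<^esub> y" using yx by (rule ker_dvd)
    have "(inv\<^bsub>D\<^esub> x \<otimes>\<^bsub>D\<^esub> r) \<otimes>\<^bsub>D\<^esub> y = \<one>\<^bsub>D\<^esub>"
      using X(3) r y D.Units_l_inv[OF X(3)] by (simp add: D.m_assoc)
    moreover from this have "y \<otimes>\<^bsub>D\<^esub> (inv\<^bsub>D\<^esub> x \<otimes>\<^bsub>D\<^esub> r) = \<one>\<^bsub>D\<^esub>"
      using X(3) r(1) y D.m_comm[of y "inv\<^bsub>D\<^esub> x \<otimes>\<^bsub>D\<^esub> r"] by simp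
    ultimately show "y \<in> Units D"
      unfolding Units_def using X(3) r(1) y by blast
  qed
  have "X <+>\<^bsub>D\<^esub> (N \<times> {\<zero>\<^bsub>S\<^esub>}) = X"
  proof
    show "X <+>\<^bsub>D\<^esub> (N \<times> {\<zero>\<^bsub>S\<^esub>}) \<subseteq> X"
    proof
      fix y assume "y \<in> X <+>\<^bsub>D\<^esub> (N \<times> {\<zero>\<^bsub>S\<^esub>})"
      then obtain w z n where wz: "(w, z) \<in> X" and n: "n \<in> N"
        and y: "y = (w \<oplus> n, z \<oplus>\<^bsub>S\<^esub> \<zero>\<^bsub>S\<^esub>)"
        by (auto simp: set_add_def' RDirProd_simps)
      have u: "w \<in> Units R" "z \<in> Units S"
        using wz X_units by (auto simp: RDirProd_Units[OF R.is_cring S.is_cring])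
      have "(w, z) \<in> carrier D" "y \<in> carrier D"
        using u N_carrier[OF n] by (simp_all add: y carrier_D R.Units_closed S.Units_closed)
      moreover have "f (w, z) = f y" if "f \<in> A" for f
        using AD(3)[OF that u n] S.Units_closed[OF u(2)] by (simp add: y)
      ultimately have "((w, z), y) \<in> ker" by (simp add: ker_iff)
      then show "y \<in> X" using in_quotient_imp_closed[OF equiv_ker X(1) wz] by blast
    qed
    have "x \<in> X <+>\<^bsub>D\<^esub> (N \<times> {\<zero>\<^bsub>S\<^esub>})" if "x \<in> X" for x
    proof -
      have "x \<in> carrier D" using that Xc by blast
      then have "x = x \<oplus>\<^bsub>D\<^esub> (\<zero>, \<zero>\<^bsub>S\<^esub>)" by (auto simp: carrier_D RDirProd_simps)
      then show ?thesis using that N.zero_closed unfolding set_add_def' by blast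
    qed
    then show "X \<subseteq> X <+>\<^bsub>D\<^esub> (N \<times> {\<zero>\<^bsub>S\<^esub>})" by blast
  qed
  from ideal_stabilizer(3)[OF D.ring_axioms finite_D Xc ideal_Times_zero this]
  have "N \<times> {\<zero>\<^bsub>S\<^esub>} \<subseteq> {(\<zero>, \<zero>\<^bsub>S\<^esub>)}" by (simp add: stab RDirProd_simps)
  then have "N \<subseteq> {\<zero>}" by auto
  then show False using assms N.zero_closed by blast
qed

text \<open>Turns a stabilizer condition into kernel pairs, which a single invariant function can
  refute.\<close>

lemma stabilizer_translate:
  assumes X: "X \<in> carrier D // ker" and J: "J \<subseteq> ideal_stabilizer D X"
    and x: "x \<in> X" and j: "j \<in> J"
  shows "(x, x \<oplus>\<^bsub>D\<^esub> j) \<in> ker"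
proof -
  have Xc: "X \<subseteq> carrier D" using X in_quotient_imp_subset[OF equiv_ker] by simp
  have "x \<oplus>\<^bsub>D\<^esub> j \<in> X <+>\<^bsub>D\<^esub> ideal_stabilizer D X"
    using x j J unfolding set_add_def' by blast
  then have "x \<oplus>\<^bsub>D\<^esub> j \<in> X" using ideal_stabilizer(2)[OF D.ring_axioms finite_D Xc] by simp
  then show ?thesis using quotient_eq_iff[OF equiv_ker X X x] by blast
qed

text \<open>One-sided closure suffices: multiplication by an element of \<open>K\<close> is an
  injective self-map of the finite set \<open>F\<close>, hence onto, and translations by
  \<open>n\<close> and \<open>m\<close> are undone by those by \<open>- n\<close> and
  \<open>- m\<close>.\<close>

lemma indicator_in_A:
  assumes F: "F \<subseteq> carrier D"
    and mult: "\<And>g h w z. (g, h) \<in> K \<Longrightarrow> (w, z) \<in> F \<Longrightarrow> (g \<otimes> w, h \<otimes>\<^bsub>S\<^esub> z) \<in> F"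
    and left: "\<And>w z n. w \<in> Units R \<Longrightarrow> z \<in> Units S \<Longrightarrow> n \<in> N \<Longrightarrow> (w, z) \<in> F \<Longrightarrow> (w \<oplus> n, z) \<in> F"
    and right: "\<And>w z m. w \<in> N \<Longrightarrow> z \<in> Units S \<Longrightarrow> m \<in> M \<Longrightarrow> (w, z) \<in> F \<Longrightarrow> (w, z \<oplus>\<^bsub>S\<^esub> m) \<in> F"
  shows "indicator F \<in> A"
proof (rule AI)
  show "(indicator F x :: int) = 0" if "x \<notin> carrier D" for x
    using that F by (auto simp: indicator_def)
  show "(indicator F (g \<otimes> w, h \<otimes>\<^bsub>S\<^esub> z) :: int) = indicator F (w, z)"
    if gh: "(g, h) \<in> K" and w: "w \<in> carrier R" and z: "z \<in> carrier S" for g h w z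
  proof -
    let ?m = "\<lambda>x. (g, h) \<otimes>\<^bsub>D\<^esub> x"
    have u: "(g, h) \<in> Units D"
      using K_D[OF gh] by (simp add: RDirProd_Units[OF R.is_cring S.is_cring])
    have inj: "inj_on ?m (carrier D)"
      using D.bij_betw_Units_mult[OF u] by (rule bij_betw_imp_inj_on)
    have "?m ` F \<subseteq> F" using mult[OF gh] by (auto simp: RDirProd_simps)
    then have "?m ` F = F"
      using endo_inj_surj[of F ?m] inj_on_subset[OF inj F] finite_subset[OF F finite_D] by blast
    moreover have "(w, z) \<in> carrier D" using w z by (simp add: carrier_D)
    ultimately have "?m (w, z) \<in> F \<longleftrightarrow> (w, z) \<in> F"
      using inj_on_image_mem_iff[OF inj _ F, of "(w, z)"] by simp
    then show ?thesis by (simp add: indicator_def RDirProd_simps)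
  qed
  show "(indicator F (w \<oplus> n, z) :: int) = indicator F (w, z)"
    if w: "w \<in> Units R" and z: "z \<in> Units S" and n: "n \<in> N" for w z n
  proof -
    have "w \<oplus> n \<oplus> \<ominus> n = w"
      using R.Units_closed[OF w] N_carrier[OF n] by (simp add: R.a_assoc R.r_neg)
    then have "(w \<oplus> n, z) \<in> F \<longleftrightarrow> (w, z) \<in> F"
      using left[OF w z n] left[OF unit_plus_N[OF w n] z N.a_inv_closed[OF n]] by auto
    then show ?thesis by (simp add: indicator_def)
  qed
  show "(indicator F (w, z \<oplus>\<^bsub>S\<^esub> m) :: int) = indicator F (w, z)"
    if w: "w \<in> N" and z: "z \<in> Units S" and m: "m \<in> M" for w z m
  proof -
    have "z \<oplus>\<^bsub>S\<^esub> m \<oplus>\<^bsub>S\<^esub> \<ominus>\<^bsub>S\<^esub> m = z"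
      using S.Units_closed[OF z] M_carrier[OF m] by (simp add: S.a_assoc S.r_neg)
    then have "(w, z \<oplus>\<^bsub>S\<^esub> m) \<in> F \<longleftrightarrow> (w, z) \<in> F"
      using right[OF w z m] right[OF w unit_plus_M[OF z m] M.a_inv_closed[OF m]] by auto
    then show ?thesis by (simp add: indicator_def)
  qed
qed

text \<open>\<open>N\<close> and \<open>M\<close> are least among the non-zero ideals, so
  \<open>J\<close> contains all of \<open>N\<close> on the left axis or all of \<open>M\<close> on
  the right one. The functions \<open>f1\<close> and \<open>f2\<close> show that such translations
  move a point outside \<open>I\<close> out of its basic set.\<close>

lemma not_gen_wreath_A:
  assumes min_N: "\<And>J. ideal J R \<Longrightarrow> J \<noteq> {\<zero>} \<Longrightarrow> N \<subseteq> J"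
    and min_M: "\<And>J. ideal J S \<Longrightarrow> J \<noteq> {\<zero>\<^bsub>S\<^esub>} \<Longrightarrow> M \<subseteq> J"
    and f1: "f1 \<in> A" "w1 \<in> Units R" "z1 \<in> carrier S" "n1 \<in> N" "f1 (w1 \<oplus> n1, z1) \<noteq> f1 (w1, z1)"
    and f2: "f2 \<in> A" "w2 \<in> carrier R" "z2 \<in> Units S" "m2 \<in> M" "f2 (w2, z2 \<oplus>\<^bsub>S\<^esub> m2) \<noteq> f2 (w2, z2)"
  shows "\<not> nontrivial_gen_wreath_product D A"
proof
  assume "nontrivial_gen_wreath_product D A"
  then obtain I J where IJ: "s_ring_ideal D A I" "s_ring_ideal D A J"
    and J0: "J \<noteq> {\<zero>\<^bsub>D\<^esub>}" and I1: "I \<noteq> carrier D"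
    and "\<forall>X\<in>carrier D // ker. X \<subseteq> carrier D - I \<longrightarrow> J \<subseteq> ideal_stabilizer D X"
    unfolding nontrivial_gen_wreath_product_def basic_sets_A
    by (elim exE conjE) (rule that; assumption)
  then have X: "\<And>X. X \<in> carrier D // ker \<Longrightarrow> X \<subseteq> carrier D - I \<Longrightarrow> J \<subseteq> ideal_stabilizer D X"
    by blast
  have I: "ideal I D" and J: "ideal J D" using IJ unfolding s_ring_ideal_def by blast+
  \<comment> \<open>The indicator of an ideal is invariant, so the basic set of a point outside
    \<open>I\<close> avoids \<open>I\<close> altogether.\<close>
  have translate: "(x, x \<oplus>\<^bsub>D\<^esub> j) \<in> ker" if x: "x \<in> carrier D" "x \<notin> I" and j: "j \<in> J" for x j
  proof (rule stabilizer_translate)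
    show cls: "ker `` {x} \<in> carrier D // ker" using x(1) by (rule quotientI)
    have "y \<notin> I" if "(x, y) \<in> ker" for y
      using ker_ideal[OF I] that x(2) equiv_ker by (meson equivE symD)
    then have "ker `` {x} \<subseteq> carrier D - I" by (auto simp: ker_iff)
    then show "J \<subseteq> ideal_stabilizer D (ker `` {x})" by (rule X[OF cls])
    show "x \<in> ker `` {x}" by (rule equiv_class_self[OF equiv_ker x(1)])
    show "j \<in> J" by (rule j)
  qed
  have J_unit: "(a \<otimes> w, b \<otimes>\<^bsub>S\<^esub> z) \<in> J" if "(w, z) \<in> J" "a \<in> carrier R" "b \<in> carrier S" for a b w z
    using ideal_mult[OF J that] .
  have Jc: "w \<in> carrier R \<and> z \<in> carrier S" if "(w, z) \<in> J" for w z
    using ideal.Icarr[OF J that] by (simp add: carrier_D)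
  have zero_J: "(\<zero>, \<zero>\<^bsub>S\<^esub>) \<in> J"
    using additive_subgroup.zero_closed[OF ideal.axioms(1)[OF J]] by (simp add: RDirProd_simps)
  have "\<not> J \<subseteq> {(\<zero>, \<zero>\<^bsub>S\<^esub>)}"
    using J0 zero_J unfolding RDirProd_simps by blast
  then have "\<exists>j\<in>J. j \<noteq> (\<zero>, \<zero>\<^bsub>S\<^esub>)" by blast
  then obtain j1 j2 where j: "(j1, j2) \<in> J" "(j1, j2) \<noteq> (\<zero>, \<zero>\<^bsub>S\<^esub>)"
    by (metis surj_pair)
  note jc = Jc[OF j(1)]
  have j1: "(j1, \<zero>\<^bsub>S\<^esub>) \<in> J" and j2: "(\<zero>, j2) \<in> J"
    using J_unit[OF j(1), of \<one> "\<zero>\<^bsub>S\<^esub>"] J_unit[OF j(1), of \<zero> "\<one>\<^bsub>S\<^esub>"] jc by simp_all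
  \<comment> \<open>A proper ideal cannot contain both idempotents \<open>(1, 0)\<close> and
    \<open>(0, 1)\<close>, whose sum is the identity.\<close>
  have or: "(\<one>, \<zero>\<^bsub>S\<^esub>) \<notin> I \<or> (\<zero>, \<one>\<^bsub>S\<^esub>) \<notin> I"
  proof (rule ccontr)
    assume "\<not> ((\<one>, \<zero>\<^bsub>S\<^esub>) \<notin> I \<or> (\<zero>, \<one>\<^bsub>S\<^esub>) \<notin> I)"
    then have "(\<one>, \<one>\<^bsub>S\<^esub>) \<in> I" using ideal_add[OF I, of \<one> "\<zero>\<^bsub>S\<^esub>" \<zero> "\<one>\<^bsub>S\<^esub>"] by simp
    then have "\<one>\<^bsub>D\<^esub> \<in> I" by (simp add: RDirProd_simps)
    then show False using I1 ideal.one_imp_carrier[OF I] by blast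
  qed
  \<comment> \<open>The basic set of \<open>(1, 0)\<close> consists of multiples of
    \<open>(1, 0)\<close>, so translation by \<open>(0, j2)\<close> can preserve it only for
    \<open>j2 = 0\<close>.\<close>
  have axis_left: "j2 = \<zero>\<^bsub>S\<^esub>" if "(\<one>, \<zero>\<^bsub>S\<^esub>) \<notin> I"
  proof -
    have "((\<one>, \<zero>\<^bsub>S\<^esub>), (\<one>, \<zero>\<^bsub>S\<^esub>) \<oplus>\<^bsub>D\<^esub> (\<zero>, j2)) \<in> ker"
      using that j2 by (intro translate) (auto simp: carrier_D)
    then obtain r where "r \<in> carrier D"
      "(\<one>, \<zero>\<^bsub>S\<^esub>) \<oplus>\<^bsub>D\<^esub> (\<zero>, j2) = r \<otimes>\<^bsub>D\<^esub> (\<one>, \<zero>\<^bsub>S\<^esub>)" by (rule ker_dvd)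
    then show ?thesis using jc by (auto simp: carrier_D RDirProd_simps)
  qed
  have axis_right: "j1 = \<zero>" if "(\<zero>, \<one>\<^bsub>S\<^esub>) \<notin> I"
  proof -
    have "((\<zero>, \<one>\<^bsub>S\<^esub>), (\<zero>, \<one>\<^bsub>S\<^esub>) \<oplus>\<^bsub>D\<^esub> (j1, \<zero>\<^bsub>S\<^esub>)) \<in> ker"
      using that j1 by (intro translate) (auto simp: carrier_D)
    then obtain r where "r \<in> carrier D"
      "(\<zero>, \<one>\<^bsub>S\<^esub>) \<oplus>\<^bsub>D\<^esub> (j1, \<zero>\<^bsub>S\<^esub>) = r \<otimes>\<^bsub>D\<^esub> (\<zero>, \<one>\<^bsub>S\<^esub>)" by (rule ker_dvd)
    then show ?thesis using jc by (auto simp: carrier_D RDirProd_simps)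
  qed
  show False
  proof (cases "j1 = \<zero>")
    case False
    \<comment> \<open>As \<open>j1\<close> is non-zero, \<open>axis_right\<close> puts
      \<open>(0, 1)\<close> into \<open>I\<close>. This expels \<open>(1, 0)\<close>, and with it
      every point whose first coordinate is a unit.\<close>
    with or axis_right have out: "(\<one>, \<zero>\<^bsub>S\<^esub>) \<notin> I" by blast
    have "(w1, z1) \<notin> I"
    proof
      assume "(w1, z1) \<in> I"
      from ideal_mult[OF I this, of "inv w1" "\<zero>\<^bsub>S\<^esub>"] show False using f1(2,3) out by simp
    qed
    moreover have "N \<subseteq> PIdl j1"
      using min_N[OF R.cgenideal_ideal] R.cgenideal_self[of j1] jc False by blast
    then obtain r where "r \<in> carrier R" "n1 = r \<otimes> j1" using f1(4) unfolding cgenideal_def by blast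
    then have "(n1, \<zero>\<^bsub>S\<^esub>) \<in> J" using J_unit[OF j1, of r "\<zero>\<^bsub>S\<^esub>"] by simp
    ultimately have "((w1, z1), (w1, z1) \<oplus>\<^bsub>D\<^esub> (n1, \<zero>\<^bsub>S\<^esub>)) \<in> ker"
      using f1(2,3) by (intro translate) (auto simp: carrier_D R.Units_closed)
    then show False using f1 by (auto simp: ker_iff RDirProd_simps)
  next
    case True
    then have "j2 \<noteq> \<zero>\<^bsub>S\<^esub>" using j(2) by simp
    with or axis_left have out: "(\<zero>, \<one>\<^bsub>S\<^esub>) \<notin> I" by blast
    have "(w2, z2) \<notin> I"
    proof
      assume "(w2, z2) \<in> I"
      from ideal_mult[OF I this, of \<zero> "inv\<^bsub>S\<^esub> z2"] show False using f2(2,3) out by simp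
    qed
    moreover have "M \<subseteq> PIdl\<^bsub>S\<^esub> j2"
      using min_M[OF S.cgenideal_ideal] S.cgenideal_self[of j2] jc \<open>j2 \<noteq> \<zero>\<^bsub>S\<^esub>\<close> by blast
    then obtain r where "r \<in> carrier S" "m2 = r \<otimes>\<^bsub>S\<^esub> j2"
      using f2(4) unfolding cgenideal_def by blast
    then have "(\<zero>, m2) \<in> J" using J_unit[OF j2, of \<zero> r] by simp
    ultimately have "((w2, z2), (w2, z2) \<oplus>\<^bsub>D\<^esub> (\<zero>, m2)) \<in> ker"
      using f2(2,3) by (intro translate) (auto simp: carrier_D S.Units_closed)
    then show False using f2 by (auto simp: ker_iff RDirProd_simps)
  qed
qed

end

section \<open>Local rings whose maximal ideal has square zero\<close>

text \<open>The structure of \<open>GR(p^2, d)\<close> that the construction uses: \<open>N\<close>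
  is an elementary abelian \<open>p\<close>-group under addition, has zero multiplication, and is
  the least non-zero ideal.\<close>

locale square_zero_local_ring = cring R for R :: "('a, 'm) ring_scheme" (structure) +
  fixes N :: "'a set" and p :: nat
  assumes finite_carrier: "finite (carrier R)"
    and prime_p: "prime p"
    and ideal_N: "ideal N R"
    and Units_N: "Units R = carrier R - N"
    and mult_N: "n \<in> N \<Longrightarrow> n' \<in> N \<Longrightarrow> n \<otimes> n' = \<zero>"
    and torsion_N: "n \<in> N \<Longrightarrow> [p] \<cdot> n = \<zero>"
    and minimal_N: "ideal J R \<Longrightarrow> J \<noteq> {\<zero>} \<Longrightarrow> N \<subseteq> J"
    and nonzero_N: "N \<noteq> {\<zero>}"
begin

sublocale N: ideal N R by (rule ideal_N)

lemma N_carrier [simp]: "n \<in> N \<Longrightarrow> n \<in> carrier R"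
  by (rule N.Icarr)

lemma add_pow_N [simp]: "n \<in> N \<Longrightarrow> [(k::nat)] \<cdot> n \<in> N"
  by (induction k) auto

section \<open>The multiplicative group \<open>1 + N\<close>\<close>

lemma one_plus_Units [simp]: "n \<in> N \<Longrightarrow> \<one> \<oplus> n \<in> Units R"
proof -
  assume n: "n \<in> N"
  have "\<one> \<oplus> n \<notin> N"
  proof
    assume "\<one> \<oplus> n \<in> N"
    then have "\<one> \<oplus> n \<oplus> \<ominus> n \<in> N" using n by (auto intro!: N.a_closed[of "\<one> \<oplus> n"])
    moreover have "\<one> \<oplus> n \<oplus> \<ominus> n = \<one>" using n by (simp add: a_assoc r_neg)
    ultimately have "\<one> \<in> N" by metis
    then show False using Units_N Units_one_closed by blast
  qed
  then show "\<one> \<oplus> n \<in> Units R" using n by (simp add: Units_N)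
qed

lemma one_plus_mult:
  assumes "n \<in> N" "n' \<in> N"
  shows "(\<one> \<oplus> n) \<otimes> (\<one> \<oplus> n') = \<one> \<oplus> (n \<oplus> n')"
proof -
  have "(\<one> \<oplus> n) \<otimes> (\<one> \<oplus> n') = \<one> \<oplus> n' \<oplus> (n \<oplus> n \<otimes> n')"
    using assms by (simp add: l_distr r_distr a_ac)
  also have "\<dots> = \<one> \<oplus> (n \<oplus> n')"
    using assms by (simp add: mult_N a_assoc a_comm[of n'])
  finally show ?thesis .
qed

lemma one_plus_pow: "n \<in> N \<Longrightarrow> (\<one> \<oplus> n) [^] (k::nat) = \<one> \<oplus> [k] \<cdot> n"
  by (induction k) (simp_all add: one_plus_mult)

text \<open>The group \<open>1 + N\<close> is killed by \<open>p\<close>, whereas \<open>s\<close>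
  has order \<open>q\<close>: raising to the power \<open>p\<close> gives
  \<open>s^(j p) = 1\<close>, so \<open>q\<close> divides \<open>j p\<close>.\<close>

lemma pow_cong_one:
  assumes s: "s \<in> Units R" "s [^] q = \<one>" "s \<noteq> \<one>" and q: "prime q" "q \<noteq> p"
    and n: "n \<in> N" "s [^] (j::nat) = \<one> \<oplus> n"
  shows "q dvd j"
proof -
  interpret U: group "units_of R" by (rule units_group)
  have sU: "s \<in> carrier (units_of R)" using s(1) by (simp add: units_of_carrier)
  have pow: "s [^]\<^bsub>units_of R\<^esub> (k::nat) = s [^] k" for k
    using s(1) by (rule units_of_pow)
  have "s [^] (j * p) = \<one>"
    using s(1) n torsion_N[OF n(1)]
    by (simp add: nat_pow_pow[symmetric] one_plus_pow Units_closed)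
  then have dvd: "U.ord s dvd j * p" using U.pow_eq_id[OF sU] by (simp add: pow units_of_one)
  have "U.ord s dvd q" using U.pow_eq_id[OF sU] s(2) by (simp add: pow units_of_one)
  moreover have "U.ord s \<noteq> 1"
    using U.pow_eq_id[OF sU, of 1] s by (simp add: units_of_mult units_of_one Units_closed)
  ultimately have "U.ord s = q" using q(1) by (auto simp: prime_nat_iff)
  with dvd q prime_p show ?thesis
    by (metis prime_dvd_mult_iff primes_dvd_imp_eq)
qed

text \<open>\<open>N0\<close> is maximal among the additively closed subsets of \<open>N\<close>
  that contain 0 and avoid \<open>x0\<close>; these are subgroups because \<open>p\<close> kills
  \<open>N\<close>. For \<open>n\<close> outside \<open>N0\<close>, maximality writes
  \<open>x0\<close> as an element of \<open>N0\<close> plus a multiple of \<open>n\<close>, and this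
  is solved for \<open>n\<close> modulo \<open>p\<close>.\<close>

lemma hyperplane:
  obtains x0 N0 where "x0 \<in> N" "x0 \<notin> N0" "N0 \<subseteq> N" "\<zero> \<in> N0"
    "\<And>h h'. h \<in> N0 \<Longrightarrow> h' \<in> N0 \<Longrightarrow> h \<oplus> h' \<in> N0"
    "\<And>n. n \<in> N \<Longrightarrow> \<exists>i::nat. \<exists>h\<in>N0. n = [i] \<cdot> x0 \<oplus> h"
proof -
  obtain x0 where x0: "x0 \<in> N" "x0 \<noteq> \<zero>" using nonzero_N N.zero_closed by blast
  define \<H> where "\<H> = {H. H \<subseteq> N \<and> \<zero> \<in> H \<and> x0 \<notin> H \<and> (\<forall>h\<in>H. \<forall>h'\<in>H. h \<oplus> h' \<in> H)}"
  have "N \<subseteq> carrier R" by auto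
  then have finN: "finite N" using finite_carrier finite_subset by blast
  have "\<H> \<subseteq> Pow N" by (auto simp: \<H>_def)
  then have "finite \<H>" using finN finite_subset by blast
  moreover have "{\<zero>} \<in> \<H>" using x0 by (simp add: \<H>_def)
  ultimately obtain N0 where N0: "N0 \<in> \<H>" and max: "\<And>H. H \<in> \<H> \<Longrightarrow> N0 \<subseteq> H \<Longrightarrow> H = N0"
    by (metis finite_has_maximal2)
  have H: "N0 \<subseteq> N" "\<zero> \<in> N0" "x0 \<notin> N0"
    and add: "\<And>h h'. h \<in> N0 \<Longrightarrow> h' \<in> N0 \<Longrightarrow> h \<oplus> h' \<in> N0"
    using N0 by (auto simp: \<H>_def)
  have mult: "[(k::nat)] \<cdot> h \<in> N0" if "h \<in> N0" for k h
    using H(2) add that by (induction k) auto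
  have "\<exists>i::nat. \<exists>h\<in>N0. n = [i] \<cdot> x0 \<oplus> h" if n: "n \<in> N" for n
  proof (cases "n \<in> N0")
    case True
    then show ?thesis using n by (intro exI[of _ 0] bexI[of _ n]) auto
  next
    case False
    define H' where "H' = {h \<oplus> [i] \<cdot> n | h (i::nat). h \<in> N0}"
    have sub: "N0 \<subseteq> H'"
    proof
      fix h assume h: "h \<in> N0"
      then have "h = h \<oplus> [(0::nat)] \<cdot> n" using H(1) n by auto
      then show "h \<in> H'" using h unfolding H'_def by blast
    qed
    have "n = \<zero> \<oplus> [(1::nat)] \<cdot> n" using n by simp
    then have "n \<in> H'" using H(2) unfolding H'_def by blast
    then have "H' \<noteq> N0" using False by blast
    then have "H' \<notin> \<H>" using max sub by blast
    moreover have "H' \<subseteq> N" using H(1) n by (auto simp: H'_def)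
    moreover have "a \<oplus> b \<in> H'" if ab: "a \<in> H'" "b \<in> H'" for a b
    proof -
      obtain h i h' i' where h: "h \<in> N0" "h' \<in> N0"
        and a: "a = h \<oplus> [(i::nat)] \<cdot> n" and b: "b = h' \<oplus> [(i'::nat)] \<cdot> n"
        using ab unfolding H'_def by blast
      have hc: "h \<in> carrier R" "h' \<in> carrier R" using h H(1) by auto
      have "a \<oplus> b = (h \<oplus> h') \<oplus> [(i + i')] \<cdot> n"
        using hc n unfolding a b
        by (simp add: add.nat_pow_mult[symmetric] a_assoc a_lcomm[of h'])
      then show ?thesis using add[OF h] unfolding H'_def by blast
    qed
    ultimately have "x0 \<in> H'" using sub H(2) by (auto simp: \<H>_def)
    then obtain h i where h: "h \<in> N0" and x0h: "x0 = h \<oplus> [(i::nat)] \<cdot> n"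
      unfolding H'_def by blast
    have hN: "h \<in> N" using h H(1) by blast
    have zero: "[(p * k)] \<cdot> a = \<zero>" if "a \<in> N" for k a
      using that by (simp add: add.nat_pow_pow[symmetric] torsion_N)
    have "\<not> p dvd i"
    proof
      assume "p dvd i"
      then have "x0 = h" using x0h zero[OF n] hN by (auto elim!: dvdE)
      then show False using h H(3) by blast
    qed
    then have "gcd i p = 1" "i \<noteq> 0"
      using prime_imp_coprime[OF prime_p]
      by (metis coprime_commute coprime_imp_gcd_eq_1, metis dvd_0_right)
    \<comment> \<open>\<open>k\<close> inverts \<open>i\<close> modulo \<open>p\<close>.\<close>
    then obtain k l where kl: "i * k = p * l + 1" using bezout_nat[of i p] by auto
    \<comment> \<open>The multiple by \<open>(p - 1) * k\<close> acts as the negative of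
      \<open>k\<close> copies of \<open>h\<close>: together they are \<open>p * k\<close> copies,
      which vanish.\<close>
    have "[k] \<cdot> x0 \<oplus> [((p - 1) * k)] \<cdot> h = [k] \<cdot> ([i] \<cdot> n) \<oplus> ([k] \<cdot> h \<oplus> [((p - 1) * k)] \<cdot> h)"
      using hN n unfolding x0h by (simp add: add.nat_pow_distrib a_ac)
    also have "[k] \<cdot> h \<oplus> [((p - 1) * k)] \<cdot> h = [(p * k)] \<cdot> h"
      using hN prime_gt_0_nat[OF prime_p] by (cases p) (simp_all add: add.nat_pow_mult)
    also have "[k] \<cdot> ([i] \<cdot> n) = [(p * l)] \<cdot> n \<oplus> n"
      using n kl by (simp add: add.nat_pow_pow)
    finally have "n = [k] \<cdot> x0 \<oplus> [((p - 1) * k)] \<cdot> h"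
      using n hN by (simp add: zero)
    then show ?thesis using mult[OF h] by blast
  qed
  then show thesis using that[OF x0(1) H(3,1,2) add] by blast
qed

end

text \<open>\<open>s_pow\<close> and \<open>s_order\<close> say that \<open>s\<close> has order
  \<open>q\<close> modulo \<open>1 + N\<close>. In the other ring \<open>p\<close> and
  \<open>q\<close> are exchanged, so that the order of each multiplier is the index of the
  hyperplane in the other ring.\<close>

locale framed_local_ring = square_zero_local_ring R N p
  for R :: "('a, 'm) ring_scheme" (structure) and N :: "'a set" and p :: nat +
  fixes s x0 :: 'a and N0 :: "'a set" and q :: nat
  assumes s_Units: "s \<in> Units R"
    and s_pow: "n \<in> N \<Longrightarrow> s [^] (j::nat) = \<one> \<oplus> n \<Longrightarrow> q dvd j"
    and s_order: "s [^] q = \<one>"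
    and x0: "x0 \<in> N" "x0 \<notin> N0"
    and N0: "N0 \<subseteq> N" "\<zero> \<in> N0"
    and N0_add: "h \<in> N0 \<Longrightarrow> h' \<in> N0 \<Longrightarrow> h \<oplus> h' \<in> N0"
    and N0_cosets: "n \<in> N \<Longrightarrow> \<exists>i::nat. \<exists>h\<in>N0. n = [i] \<cdot> x0 \<oplus> h"
begin

lemma s_closed [simp]: "s \<in> carrier R" "s [^] (j::nat) \<in> carrier R" "s [^] (j::nat) \<in> Units R"
  using s_Units by (auto intro: Units_closed Units_pow_closed)

lemma x0_N [simp]: "x0 \<in> N" "h \<in> N0 \<Longrightarrow> h \<in> N"
  using x0 N0 by auto

text \<open>Multiplying by \<open>1 - n\<close>, the inverse of \<open>1 + n\<close>, puts
  \<open>s^j\<close> into \<open>1 + N\<close>, where the only power of \<open>s\<close> is the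
  identity.\<close>

lemma s_pow_one_plus:
  assumes "n \<in> N" "n' \<in> N" "s [^] (j::nat) \<otimes> (\<one> \<oplus> n) = \<one> \<oplus> n'"
  shows "q dvd j" "n = n'"
proof -
  have "s [^] j = s [^] j \<otimes> ((\<one> \<oplus> n) \<otimes> (\<one> \<oplus> \<ominus> n))"
    using assms(1) by (simp add: one_plus_mult r_neg)
  also have "\<dots> = (\<one> \<oplus> n') \<otimes> (\<one> \<oplus> \<ominus> n)"
    using assms(1) by (simp add: m_assoc[symmetric] assms(3))
  also have "\<dots> = \<one> \<oplus> (n' \<oplus> \<ominus> n)"
    using assms(1,2) by (simp add: one_plus_mult)
  finally show "q dvd j" using assms(1,2) by (intro s_pow) auto
  then have "s [^] j = \<one>"
    using s_order s_closed by (auto elim!: dvdE simp: nat_pow_pow[symmetric] simp del: s_closed(2,3))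
  then show "n = n'" using assms by simp
qed

lemma add_pow_x0:
  assumes "p dvd i"
  shows "[i] \<cdot> x0 = \<zero>"
  using assms by (auto elim!: dvdE simp: add.nat_pow_pow[symmetric] torsion_N)

end

lemma gluing_of_framed_local_rings:
  fixes R :: "('a, 'm) ring_scheme" and S :: "('b, 'n) ring_scheme"
  assumes "framed_local_ring R N p s x0 N0 q" and "framed_local_ring S M q t y0 M0 p"
  shows "\<exists>A. ring_s_ring (RDirProd R S) A \<and> \<not> pure_s_ring (RDirProd R S) A \<and>
           dense_s_ring (RDirProd R S) A \<and> \<not> nontrivial_gen_wreath_product (RDirProd R S) A"
proof -
  interpret R: framed_local_ring R N p s x0 N0 q by fact
  interpret S: framed_local_ring S M q t y0 M0 p by fact
  \<comment> \<open>The coordinate \<open>i\<close> of an element of \<open>N\<close> along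
    \<open>x0\<close> is determined modulo \<open>p\<close> only, which is harmless because
    \<open>t^p = 1\<close>; the same holds for \<open>j\<close>, \<open>y0\<close> and
    \<open>s\<close> modulo \<open>q\<close>.\<close>
  define K where "K =
     {(\<one>\<^bsub>R\<^esub> \<oplus>\<^bsub>R\<^esub> ([i] \<cdot>\<^bsub>R\<^esub> x0 \<oplus>\<^bsub>R\<^esub> h), t [^]\<^bsub>S\<^esub> i) | (i::nat) h. h \<in> N0} \<union>
     {(s [^]\<^bsub>R\<^esub> j, \<one>\<^bsub>S\<^esub> \<oplus>\<^bsub>S\<^esub> ([j] \<cdot>\<^bsub>S\<^esub> y0 \<oplus>\<^bsub>S\<^esub> h)) | (j::nat) h. h \<in> M0}"
  have lift_left: "\<exists>h. (\<one>\<^bsub>R\<^esub> \<oplus>\<^bsub>R\<^esub> n, h) \<in> K" if "n \<in> N" for n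
    using R.N0_cosets[OF that] unfolding K_def by blast
  have lift_right: "\<exists>g. (g, \<one>\<^bsub>S\<^esub> \<oplus>\<^bsub>S\<^esub> m) \<in> K" if "m \<in> M" for m
    using S.N0_cosets[OF that] unfolding K_def by blast
  interpret G: glued_pair R S N M K
  proof
    show "K \<subseteq> Units R \<times> Units S" unfolding K_def by auto
  qed (use R.finite_carrier S.finite_carrier R.Units_N S.Units_N lift_left lift_right in auto)
  have x0c: "x0 \<in> carrier R" and y0c: "y0 \<in> carrier S" by simp_all
  have K_cases: thesis
    if "(g, h) \<in> K"
      "\<And>i n. n \<in> N0 \<Longrightarrow> g = \<one>\<^bsub>R\<^esub> \<oplus>\<^bsub>R\<^esub> ([i] \<cdot>\<^bsub>R\<^esub> x0 \<oplus>\<^bsub>R\<^esub> n) \<Longrightarrow> h = t [^]\<^bsub>S\<^esub> (i::nat) \<Longrightarrow> thesis"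
      "\<And>j m. m \<in> M0 \<Longrightarrow> g = s [^]\<^bsub>R\<^esub> (j::nat) \<Longrightarrow> h = \<one>\<^bsub>S\<^esub> \<oplus>\<^bsub>S\<^esub> ([j] \<cdot>\<^bsub>S\<^esub> y0 \<oplus>\<^bsub>S\<^esub> m) \<Longrightarrow> thesis"
    for g h thesis
    using that unfolding K_def by blast

  obtain \<pi> where \<pi>: "\<pi> \<in> M" "\<pi> \<noteq> \<zero>\<^bsub>S\<^esub>" using S.nonzero_N S.N.zero_closed by blast
  have \<pi>c: "\<pi> \<in> carrier S" using \<pi> by simp
  \<comment> \<open>the basic set of \<open>(1, \<pi>)\<close>\<close>
  define F1 where "F1 = {(s [^]\<^bsub>R\<^esub> j \<otimes>\<^bsub>R\<^esub> (\<one>\<^bsub>R\<^esub> \<oplus>\<^bsub>R\<^esub> ([i] \<cdot>\<^bsub>R\<^esub> x0 \<oplus>\<^bsub>R\<^esub> h)), t [^]\<^bsub>S\<^esub> i \<otimes>\<^bsub>S\<^esub> \<pi>)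
    | (i::nat) (j::nat) h. h \<in> N0}"
  have F1I: "(s [^]\<^bsub>R\<^esub> (j::nat) \<otimes>\<^bsub>R\<^esub> (\<one>\<^bsub>R\<^esub> \<oplus>\<^bsub>R\<^esub> ([i] \<cdot>\<^bsub>R\<^esub> x0 \<oplus>\<^bsub>R\<^esub> h)), t [^]\<^bsub>S\<^esub> (i::nat) \<otimes>\<^bsub>S\<^esub> \<pi>) \<in> F1"
    if "h \<in> N0" for i j h
    using that unfolding F1_def by blast
  have F1: "indicator F1 \<in> G.A"
  proof (rule G.indicator_in_A)
    show "F1 \<subseteq> carrier (RDirProd R S)"
      using \<pi>c by (auto simp: F1_def G.carrier_D)
  next
    fix g h w z assume gh: "(g, h) \<in> K" and wz: "(w, z) \<in> F1"
    obtain i j n where n: "n \<in> N0"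
      and w: "w = s [^]\<^bsub>R\<^esub> (j::nat) \<otimes>\<^bsub>R\<^esub> (\<one>\<^bsub>R\<^esub> \<oplus>\<^bsub>R\<^esub> ([i] \<cdot>\<^bsub>R\<^esub> x0 \<oplus>\<^bsub>R\<^esub> n))"
      and z: "z = t [^]\<^bsub>S\<^esub> (i::nat) \<otimes>\<^bsub>S\<^esub> \<pi>"
      using wz unfolding F1_def by blast
    have nc: "n \<in> carrier R" using n by simp
    from gh show "(g \<otimes>\<^bsub>R\<^esub> w, h \<otimes>\<^bsub>S\<^esub> z) \<in> F1"
    proof (rule K_cases)
      fix i' n' assume n': "n' \<in> N0"
        and g: "g = \<one>\<^bsub>R\<^esub> \<oplus>\<^bsub>R\<^esub> ([i'] \<cdot>\<^bsub>R\<^esub> x0 \<oplus>\<^bsub>R\<^esub> n')" and h: "h = t [^]\<^bsub>S\<^esub> (i'::nat)"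
      have n'c: "n' \<in> carrier R" using n' by simp
      have "g \<otimes>\<^bsub>R\<^esub> w = s [^]\<^bsub>R\<^esub> j \<otimes>\<^bsub>R\<^esub>
          (\<one>\<^bsub>R\<^esub> \<oplus>\<^bsub>R\<^esub> (([i'] \<cdot>\<^bsub>R\<^esub> x0 \<oplus>\<^bsub>R\<^esub> n') \<oplus>\<^bsub>R\<^esub> ([i] \<cdot>\<^bsub>R\<^esub> x0 \<oplus>\<^bsub>R\<^esub> n)))"
        using n n' unfolding g w
        by (subst R.one_plus_mult[symmetric]) (simp_all add: R.m_lcomm)
      also have "([i'] \<cdot>\<^bsub>R\<^esub> x0 \<oplus>\<^bsub>R\<^esub> n') \<oplus>\<^bsub>R\<^esub> ([i] \<cdot>\<^bsub>R\<^esub> x0 \<oplus>\<^bsub>R\<^esub> n) =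
          [(i' + i)] \<cdot>\<^bsub>R\<^esub> x0 \<oplus>\<^bsub>R\<^esub> (n' \<oplus>\<^bsub>R\<^esub> n)"
        using nc n'c x0c
        by (simp add: R.add.nat_pow_mult[symmetric] R.a_assoc R.a_lcomm[of n'])
      finally have "g \<otimes>\<^bsub>R\<^esub> w =
          s [^]\<^bsub>R\<^esub> j \<otimes>\<^bsub>R\<^esub> (\<one>\<^bsub>R\<^esub> \<oplus>\<^bsub>R\<^esub> ([(i' + i)] \<cdot>\<^bsub>R\<^esub> x0 \<oplus>\<^bsub>R\<^esub> (n' \<oplus>\<^bsub>R\<^esub> n)))" .
      moreover have "h \<otimes>\<^bsub>S\<^esub> z = t [^]\<^bsub>S\<^esub> (i' + i) \<otimes>\<^bsub>S\<^esub> \<pi>"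
        using \<pi>c unfolding h z by (simp add: S.nat_pow_mult[symmetric] S.m_assoc)
      ultimately show ?thesis using F1I[OF R.N0_add[OF n' n]] by simp
    next
      fix j' m assume m: "m \<in> M0"
        and g: "g = s [^]\<^bsub>R\<^esub> (j'::nat)" and h: "h = \<one>\<^bsub>S\<^esub> \<oplus>\<^bsub>S\<^esub> ([j'] \<cdot>\<^bsub>S\<^esub> y0 \<oplus>\<^bsub>S\<^esub> m)"
      \<comment> \<open>Multiplication by \<open>1 + M\<close> fixes the elements of
        \<open>M\<close>, so generators of this kind contribute only a power of
        \<open>s\<close>.\<close>
      have "z \<in> M" using \<pi>(1) unfolding z by (simp add: S.N.I_l_closed)
      then have "h \<otimes>\<^bsub>S\<^esub> z = z"
        using m unfolding h by (simp add: S.l_distr S.mult_N)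
      moreover have "g \<otimes>\<^bsub>R\<^esub> w = s [^]\<^bsub>R\<^esub> (j' + j) \<otimes>\<^bsub>R\<^esub> (\<one>\<^bsub>R\<^esub> \<oplus>\<^bsub>R\<^esub> ([i] \<cdot>\<^bsub>R\<^esub> x0 \<oplus>\<^bsub>R\<^esub> n))"
        using nc x0c unfolding g w by (simp add: R.nat_pow_mult[symmetric] R.m_assoc)
      ultimately show ?thesis using F1I[OF n] z by simp
    qed
  next
    fix w z assume wz: "(w, z) \<in> F1"
    \<comment> \<open>All points of \<open>F1\<close> have second coordinate in \<open>M\<close>, so
      both translation conditions are vacuous.\<close>
    have z: "z \<in> M" using wz \<pi>(1) by (auto simp: F1_def S.N.I_l_closed)
    show "(w \<oplus>\<^bsub>R\<^esub> n, z) \<in> F1" if "z \<in> Units S" for n using z that by (simp add: S.Units_N)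
    show "(w, z \<oplus>\<^bsub>S\<^esub> m) \<in> F1" if "z \<in> Units S" for m using z that by (simp add: S.Units_N)
  qed
  have "(\<one>\<^bsub>R\<^esub>, \<pi>) \<in> F1" using F1I[of "\<zero>\<^bsub>R\<^esub>" 0 0] R.N0 \<pi>c by simp
  moreover have "(\<one>\<^bsub>R\<^esub> \<oplus>\<^bsub>R\<^esub> x0, \<pi>) \<notin> F1"
  proof
    assume "(\<one>\<^bsub>R\<^esub> \<oplus>\<^bsub>R\<^esub> x0, \<pi>) \<in> F1"
    then obtain i j h where h: "h \<in> N0"
      and w: "\<one>\<^bsub>R\<^esub> \<oplus>\<^bsub>R\<^esub> x0 = s [^]\<^bsub>R\<^esub> (j::nat) \<otimes>\<^bsub>R\<^esub> (\<one>\<^bsub>R\<^esub> \<oplus>\<^bsub>R\<^esub> ([i] \<cdot>\<^bsub>R\<^esub> x0 \<oplus>\<^bsub>R\<^esub> h))"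
      and z: "\<pi> = t [^]\<^bsub>S\<^esub> (i::nat) \<otimes>\<^bsub>S\<^esub> \<pi>"
      unfolding F1_def by blast
    \<comment> \<open>Since \<open>t^i\<close> fixes \<pi>, the difference \<open>t^i - 1\<close>
      annihilates a non-zero element and is no unit. Hence \<open>t^i\<close> lies in
      \<open>1 + M\<close>, and \<open>p\<close> divides \<open>i\<close>.\<close>
    define m where "m = t [^]\<^bsub>S\<^esub> i \<ominus>\<^bsub>S\<^esub> \<one>\<^bsub>S\<^esub>"
    have mc: "m \<in> carrier S" and m: "t [^]\<^bsub>S\<^esub> i = \<one>\<^bsub>S\<^esub> \<oplus>\<^bsub>S\<^esub> m"
      by (simp_all add: m_def S.minus_eq S.a_lcomm[of "\<one>\<^bsub>S\<^esub>"] S.r_neg)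
    have "m \<otimes>\<^bsub>S\<^esub> \<pi> = t [^]\<^bsub>S\<^esub> i \<otimes>\<^bsub>S\<^esub> \<pi> \<ominus>\<^bsub>S\<^esub> \<pi>"
      using \<pi>c by (simp add: m_def S.minus_eq S.l_distr S.l_minus)
    also have "\<dots> = \<zero>\<^bsub>S\<^esub>" using \<pi>c by (simp add: z[symmetric] S.minus_eq S.r_neg)
    finally have m\<pi>: "m \<otimes>\<^bsub>S\<^esub> \<pi> = \<zero>\<^bsub>S\<^esub>" .
    have "m \<in> M"
    proof (rule ccontr)
      assume "m \<notin> M"
      then have mU: "m \<in> Units S" using mc by (simp add: S.Units_N)
      have "\<pi> = inv\<^bsub>S\<^esub> m \<otimes>\<^bsub>S\<^esub> (m \<otimes>\<^bsub>S\<^esub> \<pi>)"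
        using mU mc \<pi>c by (simp add: S.m_assoc[symmetric])
      then show False using m\<pi> mU \<pi>(2) by simp
    qed
    then have "p dvd i" using S.s_pow m by blast
    \<comment> \<open>The components in \<open>1 + N\<close> must agree. As \<open>p\<close> divides
      \<open>i\<close>, the multiple of \<open>x0\<close> vanishes and \<open>x0\<close> would lie
      in \<open>N0\<close>.\<close>
    moreover have "[i] \<cdot>\<^bsub>R\<^esub> x0 \<oplus>\<^bsub>R\<^esub> h = x0"
      using h by (intro R.s_pow_one_plus(2)[OF _ _ w[symmetric]]) auto
    ultimately have "x0 = h" using h R.add_pow_x0 by simp
    then show False using h R.x0 by simp
  qed
  ultimately have sep1: "(indicator F1 (\<one>\<^bsub>R\<^esub> \<oplus>\<^bsub>R\<^esub> x0, \<pi>) :: int) \<noteq> indicator F1 (\<one>\<^bsub>R\<^esub>, \<pi>)"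
    by simp

  \<comment> \<open>the basic set of \<open>(1, 1)\<close>\<close>
  define F2 where "F2 = {(s [^]\<^bsub>R\<^esub> j \<otimes>\<^bsub>R\<^esub> (\<one>\<^bsub>R\<^esub> \<oplus>\<^bsub>R\<^esub> n),
      t [^]\<^bsub>S\<^esub> i \<otimes>\<^bsub>S\<^esub> (\<one>\<^bsub>S\<^esub> \<oplus>\<^bsub>S\<^esub> ([j] \<cdot>\<^bsub>S\<^esub> y0 \<oplus>\<^bsub>S\<^esub> h)))
    | (i::nat) (j::nat) n h. n \<in> N \<and> h \<in> M0}"
  have F2I: "(s [^]\<^bsub>R\<^esub> (j::nat) \<otimes>\<^bsub>R\<^esub> (\<one>\<^bsub>R\<^esub> \<oplus>\<^bsub>R\<^esub> n),
      t [^]\<^bsub>S\<^esub> (i::nat) \<otimes>\<^bsub>S\<^esub> (\<one>\<^bsub>S\<^esub> \<oplus>\<^bsub>S\<^esub> ([j] \<cdot>\<^bsub>S\<^esub> y0 \<oplus>\<^bsub>S\<^esub> h))) \<in> F2"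
    if "n \<in> N" "h \<in> M0" for i j n h
    using that unfolding F2_def by blast
  have F2E: thesis if "(w, z) \<in> F2"
      "\<And>i j n h. n \<in> N \<Longrightarrow> h \<in> M0 \<Longrightarrow> w = s [^]\<^bsub>R\<^esub> (j::nat) \<otimes>\<^bsub>R\<^esub> (\<one>\<^bsub>R\<^esub> \<oplus>\<^bsub>R\<^esub> n) \<Longrightarrow>
        z = t [^]\<^bsub>S\<^esub> (i::nat) \<otimes>\<^bsub>S\<^esub> (\<one>\<^bsub>S\<^esub> \<oplus>\<^bsub>S\<^esub> ([j] \<cdot>\<^bsub>S\<^esub> y0 \<oplus>\<^bsub>S\<^esub> h)) \<Longrightarrow> thesis"
    for w z thesis
    using that unfolding F2_def by blast
  have F2: "indicator F2 \<in> G.A"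
  proof (rule G.indicator_in_A)
    show "F2 \<subseteq> carrier (RDirProd R S)"
      by (auto simp: F2_def G.carrier_D)
  next
    fix g h w z assume gh: "(g, h) \<in> K" and wz: "(w, z) \<in> F2"
    from wz obtain i j n m where n: "n \<in> N" and m: "m \<in> M0"
      and w: "w = s [^]\<^bsub>R\<^esub> (j::nat) \<otimes>\<^bsub>R\<^esub> (\<one>\<^bsub>R\<^esub> \<oplus>\<^bsub>R\<^esub> n)"
      and z: "z = t [^]\<^bsub>S\<^esub> (i::nat) \<otimes>\<^bsub>S\<^esub> (\<one>\<^bsub>S\<^esub> \<oplus>\<^bsub>S\<^esub> ([j] \<cdot>\<^bsub>S\<^esub> y0 \<oplus>\<^bsub>S\<^esub> m))"
      by (rule F2E)
    have mc: "m \<in> carrier S" using m by simp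
    from gh show "(g \<otimes>\<^bsub>R\<^esub> w, h \<otimes>\<^bsub>S\<^esub> z) \<in> F2"
    proof (rule K_cases)
      fix i' n' assume n': "n' \<in> N0"
        and g: "g = \<one>\<^bsub>R\<^esub> \<oplus>\<^bsub>R\<^esub> ([i'] \<cdot>\<^bsub>R\<^esub> x0 \<oplus>\<^bsub>R\<^esub> n')" and h: "h = t [^]\<^bsub>S\<^esub> (i'::nat)"
      have gn: "[i'] \<cdot>\<^bsub>R\<^esub> x0 \<oplus>\<^bsub>R\<^esub> n' \<oplus>\<^bsub>R\<^esub> n \<in> N" using n n' by simp
      have "g \<otimes>\<^bsub>R\<^esub> w = s [^]\<^bsub>R\<^esub> j \<otimes>\<^bsub>R\<^esub> (\<one>\<^bsub>R\<^esub> \<oplus>\<^bsub>R\<^esub> ([i'] \<cdot>\<^bsub>R\<^esub> x0 \<oplus>\<^bsub>R\<^esub> n' \<oplus>\<^bsub>R\<^esub> n))"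
        using n n' unfolding g w
        by (subst R.one_plus_mult[symmetric]) (simp_all add: R.m_lcomm)
      moreover have "h \<otimes>\<^bsub>S\<^esub> z =
          t [^]\<^bsub>S\<^esub> (i' + i) \<otimes>\<^bsub>S\<^esub> (\<one>\<^bsub>S\<^esub> \<oplus>\<^bsub>S\<^esub> ([j] \<cdot>\<^bsub>S\<^esub> y0 \<oplus>\<^bsub>S\<^esub> m))"
        using mc y0c unfolding h z by (simp add: S.nat_pow_mult[symmetric] S.m_assoc)
      ultimately show ?thesis using F2I[OF gn m] by simp
    next
      fix j' m' assume m': "m' \<in> M0"
        and g: "g = s [^]\<^bsub>R\<^esub> (j'::nat)" and h: "h = \<one>\<^bsub>S\<^esub> \<oplus>\<^bsub>S\<^esub> ([j'] \<cdot>\<^bsub>S\<^esub> y0 \<oplus>\<^bsub>S\<^esub> m')"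
      have m'c: "m' \<in> carrier S" using m' by simp
      have "h \<otimes>\<^bsub>S\<^esub> z = t [^]\<^bsub>S\<^esub> i \<otimes>\<^bsub>S\<^esub>
          (\<one>\<^bsub>S\<^esub> \<oplus>\<^bsub>S\<^esub> (([j'] \<cdot>\<^bsub>S\<^esub> y0 \<oplus>\<^bsub>S\<^esub> m') \<oplus>\<^bsub>S\<^esub> ([j] \<cdot>\<^bsub>S\<^esub> y0 \<oplus>\<^bsub>S\<^esub> m)))"
        using m m' unfolding h z
        by (subst S.one_plus_mult[symmetric]) (simp_all add: S.m_lcomm)
      also have "([j'] \<cdot>\<^bsub>S\<^esub> y0 \<oplus>\<^bsub>S\<^esub> m') \<oplus>\<^bsub>S\<^esub> ([j] \<cdot>\<^bsub>S\<^esub> y0 \<oplus>\<^bsub>S\<^esub> m) =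
          [(j' + j)] \<cdot>\<^bsub>S\<^esub> y0 \<oplus>\<^bsub>S\<^esub> (m' \<oplus>\<^bsub>S\<^esub> m)"
        using mc m'c y0c
        by (simp add: S.add.nat_pow_mult[symmetric] S.a_assoc S.a_lcomm[of m'])
      finally have "h \<otimes>\<^bsub>S\<^esub> z =
          t [^]\<^bsub>S\<^esub> i \<otimes>\<^bsub>S\<^esub> (\<one>\<^bsub>S\<^esub> \<oplus>\<^bsub>S\<^esub> ([(j' + j)] \<cdot>\<^bsub>S\<^esub> y0 \<oplus>\<^bsub>S\<^esub> (m' \<oplus>\<^bsub>S\<^esub> m)))" .
      moreover have "g \<otimes>\<^bsub>R\<^esub> w = s [^]\<^bsub>R\<^esub> (j' + j) \<otimes>\<^bsub>R\<^esub> (\<one>\<^bsub>R\<^esub> \<oplus>\<^bsub>R\<^esub> n)"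
        using n unfolding g w by (simp add: R.nat_pow_mult[symmetric] R.m_assoc)
      ultimately show ?thesis using F2I[OF n S.N0_add[OF m' m]] by simp
    qed
  next
    fix w z n' assume n': "n' \<in> N" and wz: "(w, z) \<in> F2"
    from wz obtain i j n m where n: "n \<in> N" and m: "m \<in> M0"
      and w: "w = s [^]\<^bsub>R\<^esub> (j::nat) \<otimes>\<^bsub>R\<^esub> (\<one>\<^bsub>R\<^esub> \<oplus>\<^bsub>R\<^esub> n)"
      and z: "z = t [^]\<^bsub>S\<^esub> (i::nat) \<otimes>\<^bsub>S\<^esub> (\<one>\<^bsub>S\<^esub> \<oplus>\<^bsub>S\<^esub> ([j] \<cdot>\<^bsub>S\<^esub> y0 \<oplus>\<^bsub>S\<^esub> m))"
      by (rule F2E)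
    \<comment> \<open>\<open>k\<close> is \<open>n'\<close> pulled through the factor
      \<open>s^j\<close>; the first coordinate of \<open>F2\<close> admits all of \<open>N\<close>,
      so the translate stays in \<open>F2\<close>.\<close>
    define k where "k = inv\<^bsub>R\<^esub> (s [^]\<^bsub>R\<^esub> j) \<otimes>\<^bsub>R\<^esub> n'"
    have k: "k \<in> N" using n' unfolding k_def by (simp add: R.N.I_l_closed)
    have "s [^]\<^bsub>R\<^esub> j \<otimes>\<^bsub>R\<^esub> k = n'"
      using n' unfolding k_def by (simp add: R.m_assoc[symmetric])
    then have "w \<oplus>\<^bsub>R\<^esub> n' = s [^]\<^bsub>R\<^esub> j \<otimes>\<^bsub>R\<^esub> (\<one>\<^bsub>R\<^esub> \<oplus>\<^bsub>R\<^esub> (n \<oplus>\<^bsub>R\<^esub> k))"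
      using n n' k unfolding w by (simp add: R.r_distr R.a_assoc)
    then show "(w \<oplus>\<^bsub>R\<^esub> n', z) \<in> F2" using F2I[of "n \<oplus>\<^bsub>R\<^esub> k"] n k m z by simp
  next
    fix w z m assume w: "w \<in> N" and wz: "(w, z) \<in> F2"
    \<comment> \<open>First coordinates of points of \<open>F2\<close> are units, so the condition
      on translation by \<open>M\<close> is vacuous.\<close>
    from wz have "w \<in> Units R" by (rule F2E) simp
    then show "(w, z \<oplus>\<^bsub>S\<^esub> m) \<in> F2" using w by (simp add: R.Units_N)
  qed
  have "(\<one>\<^bsub>R\<^esub>, \<one>\<^bsub>S\<^esub>) \<in> F2" using F2I[of "\<zero>\<^bsub>R\<^esub>" "\<zero>\<^bsub>S\<^esub>" 0 0] S.N0 by simp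
  moreover have "(\<one>\<^bsub>R\<^esub>, \<one>\<^bsub>S\<^esub> \<oplus>\<^bsub>S\<^esub> y0) \<notin> F2"
  proof
    assume "(\<one>\<^bsub>R\<^esub>, \<one>\<^bsub>S\<^esub> \<oplus>\<^bsub>S\<^esub> y0) \<in> F2"
    then obtain i j n h where n: "n \<in> N" and h: "h \<in> M0"
      and w: "\<one>\<^bsub>R\<^esub> = s [^]\<^bsub>R\<^esub> (j::nat) \<otimes>\<^bsub>R\<^esub> (\<one>\<^bsub>R\<^esub> \<oplus>\<^bsub>R\<^esub> n)"
      and z: "\<one>\<^bsub>S\<^esub> \<oplus>\<^bsub>S\<^esub> y0 = t [^]\<^bsub>S\<^esub> (i::nat) \<otimes>\<^bsub>S\<^esub> (\<one>\<^bsub>S\<^esub> \<oplus>\<^bsub>S\<^esub> ([j] \<cdot>\<^bsub>S\<^esub> y0 \<oplus>\<^bsub>S\<^esub> h))"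
      by (rule F2E)
    \<comment> \<open>The first coordinate forces \<open>q\<close> to divide \<open>j\<close>, which
      kills the multiple of \<open>y0\<close> in the second; then \<open>y0\<close> would lie in
      \<open>M0\<close>.\<close>
    have "s [^]\<^bsub>R\<^esub> j \<otimes>\<^bsub>R\<^esub> (\<one>\<^bsub>R\<^esub> \<oplus>\<^bsub>R\<^esub> n) = \<one>\<^bsub>R\<^esub> \<oplus>\<^bsub>R\<^esub> \<zero>\<^bsub>R\<^esub>" using w by simp
    then have "q dvd j" by (rule R.s_pow_one_plus(1)[OF n R.N.zero_closed])
    moreover have "[j] \<cdot>\<^bsub>S\<^esub> y0 \<oplus>\<^bsub>S\<^esub> h = y0"
      using h by (intro S.s_pow_one_plus(2)[OF _ _ z[symmetric]]) auto
    ultimately have "y0 = h" using h S.add_pow_x0 by simp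
    then show False using h S.x0 by simp
  qed
  ultimately have sep2: "(indicator F2 (\<one>\<^bsub>R\<^esub>, \<one>\<^bsub>S\<^esub> \<oplus>\<^bsub>S\<^esub> y0) :: int) \<noteq> indicator F2 (\<one>\<^bsub>R\<^esub>, \<one>\<^bsub>S\<^esub>)"
    by simp

  have "\<not> nontrivial_gen_wreath_product (RDirProd R S) G.A"
    by (rule G.not_gen_wreath_A[OF R.minimal_N S.minimal_N F1 R.Units_one_closed \<pi>c R.x0(1) sep1
          F2 R.one_closed S.Units_one_closed S.x0(1) sep2])
  then show ?thesis
    using G.ring_s_ring_A G.dense_A G.not_pure_A[OF R.nonzero_N] by blast
qed

section \<open>Galois rings of characteristic a prime square\<close>

text \<open>The principal ideal of a non-unit is proper, and finiteness provides a maximal proper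
  ideal above it.\<close>

lemma (in cring) nonunit_in_maximalideal:
  assumes fin: "finite (carrier R)" and a: "a \<in> carrier R" "a \<notin> Units R"
  obtains M where "maximalideal M R" "a \<in> M"
proof -
  define \<I> where "\<I> = {I. ideal I R \<and> I \<noteq> carrier R}"
  have "\<I> \<subseteq> Pow (carrier R)" by (auto simp: \<I>_def dest: ideal.Icarr)
  then have "finite \<I>" using fin finite_subset by blast
  moreover have "PIdl a \<in> \<I>"
  proof -
    have "\<one> \<notin> PIdl a"
    proof
      assume "\<one> \<in> PIdl a"
      then obtain r where "r \<in> carrier R" "\<one> = r \<otimes> a" unfolding cgenideal_def by blast
      then show False using a m_comm[of r a] unfolding Units_def by auto
    qed
    then show ?thesis using cgenideal_ideal[OF a(1)] by (auto simp: \<I>_def)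
  qed
  ultimately obtain M where M: "M \<in> \<I>" "PIdl a \<subseteq> M" and max: "\<And>I. I \<in> \<I> \<Longrightarrow> M \<subseteq> I \<Longrightarrow> I = M"
    by (metis finite_has_maximal2)
  have "maximalideal M R"
    using M(1) max by (intro maximalidealI) (auto simp: \<I>_def)
  moreover have "a \<in> M" using M(2) cgenideal_self[OF a(1)] by blast
  ultimately show thesis by (rule that)
qed

text \<open>\<open>N\<close> is the ideal generated by \<open>p\<close>, the unique maximal ideal.
  Its properties come from \<open>p^2 = 0\<close> and \<open>p \<noteq> 0\<close> in the ring; the
  units fill all but one of the \<open>p^d\<close> cosets of \<open>N\<close>.\<close>

lemma galois_ring_square_zero:
  fixes R (structure)
  assumes p: "prime p" and gal: "galois_ring R p 2 d"
  obtains N where "square_zero_local_ring R N p" "card (Units R) = (p ^ d - 1) * card N"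
proof -
  interpret cring R using gal by (simp add: galois_ring_def)
  have fin: "finite (carrier R)" and ex1: "\<exists>!M. maximalideal M R"
    and char: "group.ord (add_monoid R) \<one> = p ^ 2"
    and rad: "ring_radical R = PIdl ([p] \<cdot> \<one>)"
    and card_quot: "card (carrier (R Quot ring_radical R)) = p ^ d"
    using gal by (auto simp: galois_ring_def)
  define N where "N = PIdl ([p] \<cdot> \<one>)"
  obtain M where M: "maximalideal M R" and uniq: "\<And>M'. maximalideal M' R \<Longrightarrow> M' = M"
    using ex1 by blast
  have M_ideal: "ideal M R" using M by (rule maximalideal.axioms)
  have "{M. maximalideal M R} = {M}" using M uniq by blast
  then have "ring_radical R = M"
    using ideal.Icarr[OF M_ideal] by (auto simp: ring_radical_def)
  then have NM: "N = M" using rad by (simp add: N_def)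
  have ideal_N: "ideal N R" using M_ideal NM by simp
  interpret N: ideal N R by (rule ideal_N)
  have N_mem: "n \<in> N \<longleftrightarrow> (\<exists>r\<in>carrier R. n = r \<otimes> [p] \<cdot> \<one>)" for n
    unfolding N_def cgenideal_def by auto
  have pow_zero: "[k] \<cdot> \<one> = \<zero> \<longleftrightarrow> p ^ 2 dvd k" for k :: nat
    using group.pow_eq_id[OF a_group, of \<one> k] char by (simp add: add_pow_def)
  have units: "Units R = carrier R - N"
  proof -
    have "a \<notin> N" if "a \<in> Units R" for a
    proof
      assume "a \<in> N"
      then have "inv a \<otimes> a \<in> N" using that by (intro N.I_l_closed) auto
      then have "\<one> \<in> M" using that NM by simp
      then show False
        using ideal.one_imp_carrier[OF M_ideal] maximalideal.I_notcarr[OF M] by simp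
    qed
    moreover have "a \<in> N" if "a \<in> carrier R" "a \<notin> Units R" for a
      using nonunit_in_maximalideal[OF fin that] uniq NM by metis
    ultimately show ?thesis by (auto intro: Units_closed)
  qed
  have torsion: "[p] \<cdot> n = \<zero>" if n: "n \<in> N" for n
  proof -
    obtain r where r: "r \<in> carrier R" "n = r \<otimes> [p] \<cdot> \<one>" using n N_mem by blast
    have "[p] \<cdot> n = r \<otimes> [p] \<cdot> ([p] \<cdot> \<one>)" using r by (simp add: add_pow_rdistr)
    also have "[p] \<cdot> ([p] \<cdot> \<one>) = \<zero>"
      using pow_zero[of "p * p"] by (simp add: add.nat_pow_pow power2_eq_square)
    finally show ?thesis using r by simp
  qed
  have mult: "n \<otimes> n' = \<zero>" if "n \<in> N" "n' \<in> N" for n n'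
  proof -
    from that(2) obtain r where r: "r \<in> carrier R" "n' = r \<otimes> [p] \<cdot> \<one>" using N_mem by blast
    have "n \<otimes> n' = [p] \<cdot> (n \<otimes> r)"
      using r N.Icarr[OF that(1)] by (simp add: m_assoc[symmetric] add_pow_rdistr)
    also have "\<dots> = \<zero>" using that(1) r(1) by (intro torsion N.I_r_closed)
    finally show ?thesis .
  qed
  have p1: "[p] \<cdot> \<one> \<in> N" unfolding N_def by (rule cgenideal_self) simp
  have p1_nonzero: "[p] \<cdot> \<one> \<noteq> \<zero>"
    using pow_zero[of p] prime_gt_1_nat[OF p] by (auto simp: power2_eq_square dest: dvd_imp_le)
  \<comment> \<open>A non-zero \<open>j\<close> is a unit or equals \<open>r * p\<close> with
    \<open>r\<close> a unit, as \<open>N * N = 0\<close> excludes \<open>r\<close> in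
    \<open>N\<close>. Either way \<open>p\<close> is a multiple of \<open>j\<close>.\<close>
  have minimal: "N \<subseteq> J" if J: "ideal J R" "J \<noteq> {\<zero>}" for J
  proof -
    have "\<zero> \<in> J" using additive_subgroup.zero_closed[OF ideal.axioms(1)[OF J(1)]] .
    then obtain j where j: "j \<in> J" "j \<noteq> \<zero>" using J(2) by blast
    have jc: "j \<in> carrier R" by (rule ideal.Icarr[OF J(1) j(1)])
    have inv_J: "a \<otimes> j \<in> J" if "a \<in> carrier R" for a
      using ideal.I_l_closed[OF J(1) j(1) that] .
    have "[p] \<cdot> \<one> \<in> J"
    proof (cases "j \<in> N")
      case True
      then obtain r where r: "r \<in> carrier R" "j = r \<otimes> [p] \<cdot> \<one>" using N_mem by blast
      have "r \<notin> N" using mult[OF _ p1] r j(2) by auto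
      then have ru: "r \<in> Units R" using r units by simp
      have "inv r \<otimes> j = [p] \<cdot> \<one>" using ru r by (simp add: m_assoc[symmetric])
      then show ?thesis using inv_J[of "inv r"] ru by simp
    next
      case False
      then have ju: "j \<in> Units R" using jc units by simp
      have "([p] \<cdot> \<one> \<otimes> inv j) \<otimes> j = [p] \<cdot> \<one>" using ju jc by (simp add: m_assoc)
      then show ?thesis using inv_J[of "[p] \<cdot> \<one> \<otimes> inv j"] ju by simp
    qed
    then show ?thesis unfolding N_def by (rule cgenideal_minimal[OF J(1)])
  qed
  have "square_zero_local_ring R N p"
    using fin p ideal_N units mult torsion minimal p1 p1_nonzero
    by unfold_locales auto
  moreover have "card (Units R) = (p ^ d - 1) * card N"
  proof -
    have sub: "N \<subseteq> carrier R" using N.Icarr by blast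
    have "card (a_rcosets N) * card N = card (carrier R)"
      using a_lagrange[OF fin N.additive_subgroup_axioms] by (simp add: order_def)
    moreover have "card (a_rcosets N) = p ^ d"
      using card_quot rad by (simp add: N_def FactRing_def)
    ultimately have "card (carrier R) = p ^ d * card N" by simp
    moreover have "card (Units R) = card (carrier R) - card N"
      unfolding units using sub fin by (intro card_Diff_subset) (auto intro: finite_subset)
    ultimately show ?thesis by (simp add: diff_mult_distrib)
  qed
  ultimately show thesis by (rule that)
qed

text \<open>Cauchy's theorem, obtained from Sylow's with exponent 1; the cofactor \<open>m\<close>
  may itself be divisible by \<open>q\<close>.\<close>

lemma (in group) prime_order_element:
  assumes q: "prime q" "q dvd order G" and fin: "finite (carrier G)"
  obtains s where "s \<in> carrier G" "s [^] q = \<one>" "s \<noteq> \<one>"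
proof -
  obtain m where "order G = q ^ 1 * m" using q(2) by (auto elim: dvdE)
  from sylow_thm[OF q(1) is_group this fin]
  obtain H where H: "subgroup H G" "card H = q" by auto
  then have "H \<noteq> {\<one>}" using prime_gt_1_nat[OF q(1)] by auto
  then obtain s where s: "s \<in> H" "s \<noteq> \<one>" using subgroup.one_closed[OF H(1)] by blast
  interpret H: group "G\<lparr>carrier := H\<rparr>" by (rule subgroup.subgroup_is_group[OF H(1) is_group])
  have "s [^]\<^bsub>G\<lparr>carrier := H\<rparr>\<^esub> q = \<one>"
    using H.pow_order_eq_1[of s] s(1) H(2) by (simp add: order_def)
  then have "s [^] q = \<one>" by (simp add: nat_pow_consistent[symmetric])
  then show thesis using that s subgroup.subset[OF H(1)] by blast
qed

text \<open>\<open>q\<close> divides \<open>p^d - 1\<close> and hence the number of units, so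
  Cauchy's theorem supplies \<open>s\<close>; by \<open>pow_cong_one\<close> its order stays
  \<open>q\<close> modulo \<open>1 + N\<close>.\<close>

lemma galois_ring_framed:
  assumes p: "prime p" and q: "prime q" "q \<noteq> p" and gal: "galois_ring R p 2 d"
    and dvd: "q dvd p ^ d - 1"
  shows "\<exists>N s x0 N0. framed_local_ring R N p s x0 N0 q"
proof -
  obtain N where N: "square_zero_local_ring R N p" and card: "card (Units R) = (p ^ d - 1) * card N"
    by (rule galois_ring_square_zero[OF p gal])
  interpret square_zero_local_ring R N p by (rule N)
  interpret U: group "units_of R" by (rule units_group)
  have "q dvd order (units_of R)" "finite (carrier (units_of R))"
    using card dvd finite_carrier by (simp_all add: order_def units_of_carrier Units_N)
  then obtain s where "s \<in> carrier (units_of R)" "s [^]\<^bsub>units_of R\<^esub> q = \<one>\<^bsub>units_of R\<^esub>"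
    "s \<noteq> \<one>\<^bsub>units_of R\<^esub>"
    using U.prime_order_element[OF q(1)] by blast
  then have s: "s \<in> Units R" "s [^]\<^bsub>R\<^esub> q = \<one>\<^bsub>R\<^esub>" "s \<noteq> \<one>\<^bsub>R\<^esub>"
    using units_of_pow[of s q] by (simp_all add: units_of_carrier units_of_one)
  obtain x0 N0 where hyp: "x0 \<in> N" "x0 \<notin> N0" "N0 \<subseteq> N" "\<zero>\<^bsub>R\<^esub> \<in> N0"
    "\<And>h h'. h \<in> N0 \<Longrightarrow> h' \<in> N0 \<Longrightarrow> h \<oplus>\<^bsub>R\<^esub> h' \<in> N0"
    "\<And>n. n \<in> N \<Longrightarrow> \<exists>i::nat. \<exists>h\<in>N0. n = [i] \<cdot>\<^bsub>R\<^esub> x0 \<oplus>\<^bsub>R\<^esub> h"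
    by (rule hyperplane) blast
  have "framed_local_ring R N p s x0 N0 q"
    using s hyp pow_cong_one[OF s q] by unfold_locales auto
  then show ?thesis by blast
qed

theorem theorem1p1:
  fixes p q d e :: nat
    and Rp :: "('a, 'm) ring_scheme"
    and Rq :: "('b, 'n) ring_scheme"
  assumes "prime p" and "prime q" and "p \<noteq> q"
    and "d > 0" and "e > 0"
    and "p dvd q ^ e - 1" and "q dvd p ^ d - 1"
    and "galois_ring Rp p 2 d" and "galois_ring Rq q 2 e"
  shows "\<exists>A. ring_s_ring (RDirProd Rp Rq) A \<and>
             \<not> pure_s_ring (RDirProd Rp Rq) A \<and>
             dense_s_ring (RDirProd Rp Rq) A \<and>
             \<not> nontrivial_gen_wreath_product (RDirProd Rp Rq) A"
proof -
  obtain N s x0 N0 where "framed_local_ring Rp N p s x0 N0 q"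
    using galois_ring_framed[of p q Rp d] assms by blast
  \<comment> \<open>The hypotheses are symmetric under exchanging the two rings together with their
    primes.\<close>
  moreover obtain M t y0 M0 where "framed_local_ring Rq M q t y0 M0 p"
    using galois_ring_framed[of q p Rq e] assms by blast
  ultimately show ?thesis by (rule gluing_of_framed_local_rings)
qed

end
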